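(* Let $n,m\ge0$ be integers with $n+m\ge1$, let $h\in\mathbb C$ be such that $q=e^h$ is not a root of unity, put $\bar q=q^{-1}$, and let $p\in\mathbb C$. The transformation of the basis $|p;r_1,\dots,r_{n+m}\rangle$ of the $U_q[sl(n+1|m)]$-module $\bar W_p$ under the action of the Jacobson generators $H_i,a_i^\pm$ ($i\in[1;n+m]$) reads: $$H_i|p;r_1,\dots,r_{n+m}\rangle=\Bigl(p-(-1)^{\theta_i}r_i-\sum_{j=1}^{n+m}r_j\Bigr)|p;r_1,\dots,r_{n+m}\rangle,$$ $$a_i^-|p;r_1,\dots,r_{n+m}\rangle=(-1)^{\theta_1r_1+\cdots+\theta_{i-1}r_{i-1}}q^{r_1+\cdots+r_{i-1}}[r_i]\Bigl[p-\sum_{j=1}^{n+m}r_j+1\Bigr]\,|p;r_1,\dots,r_{i-1},r_i-1,r_{i+1},\dots,r_{n+m}\rangle,$$ $$a_i^+|p;r_1,\dots,r_{n+m}\rangle=(-1)^{\theta_1r_1+\cdots+\theta_{i-1}r_{i-1}}\bar q^{\,r_1+\cdots+r_{i-1}}(1-\theta_ir_i)\,|p;r_1,\dots,r_{i-1},r_i+1,r_{i+1},\dots,r_{n+m}\rangle.$$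
   Context: Notation: $q^x=e^{hx}$ and $[x]=\frac{q^x-q^{-x}}{q-q^{-1}}$ for $x\in\mathbb C$; $[r;s]=\{r,r+1,\dots,s\}$; $\theta_i=0$ for $i\in[0;n]$ and $\theta_i=1$ for $i\in[n+1;n+m]$ (in $\mathbb Z_2$, read as integers $0,1$ where needed); $\theta_{ij}=\theta_i+\theta_j$. For homogeneous $a,b$ in a superalgebra, $[a,b]=ab-ba$, $[\![a,b]\!]=ab-(-1)^{\deg(a)\deg(b)}ba$, $[\![a,b]\!]_x=ab-(-1)^{\deg(a)\deg(b)}x\,ba$. $\theta(i_1>\dots>i_r)=1$ if the inequalities hold and $0$ otherwise. The algebra: $U_q[sl(n+1|m)]$ is the associative superalgebra over $\mathbb C$ generated by even elements $H_i$, $L_i=q^{H_i}$, $\bar L_i=L_i^{-1}=q^{-H_i}$ ($i\in[1;n+m]$; all commuting; put $L_0=\bar L_0=1$) and elements $e_{ij}$ ($i\ne j\in[0;n+m]$) of degree $\theta_{ij}$, with the relations below. Call $e_{ij}$ a positive (negative) root vector if $i<j$ ($i>j$); among the positive ones, and likewise among the negative ones, set $e_{ij}<e_{kl}$ if $i<k$, or $i=k$ and $j<l$. (1) $[H_i,e_{jk}]=c\,e_{jk}$ and $L_ie_{jk}=q^{c}e_{jk}L_i$ with $c=\delta_{0j}-\delta_{0k}-(-1)^{\theta_i}(\delta_{ij}-\delta_{ik})$; $(e_{ij})^2=0$ if $\theta_{ij}=1$. (2) For positive root vectors $e_{ij}<e_{kl}$: $[\![e_{ij},e_{kl}]\!]_{x}=\delta_{jk}e_{il}+(q-q^{-1})(-1)^{\theta_k}\theta(l>j>k>i)e_{kj}e_{il}$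 with $x=q^{(-1)^{\theta_j}\delta_{jl}-(-1)^{\theta_j}\delta_{jk}+(-1)^{\theta_i}\delta_{ik}}$. (3) For negative root vectors $e_{ij}>e_{kl}$: $[\![e_{ij},e_{kl}]\!]_{x}=\delta_{jk}e_{il}-(q-q^{-1})(-1)^{\theta_k}\theta(i>k>j>l)e_{kj}e_{il}$ with $x=q^{-(-1)^{\theta_j}\delta_{jl}+(-1)^{\theta_j}\delta_{jk}-(-1)^{\theta_i}\delta_{ik}}$. (4) For $e_{ij}$ positive and $e_{kl}$ negative: $[\![e_{ij},e_{kl}]\!]=\frac{\delta_{il}\delta_{jk}}{q-q^{-1}}\bigl(L_j^{(-1)^{\theta_i}}\bar L_i^{(-1)^{\theta_i}}-\bar L_j^{(-1)^{\theta_i}}L_i^{(-1)^{\theta_i}}\bigr)+\bigl((q-q^{-1})\theta(j>k>i>l)(-1)^{\theta_k}e_{kj}e_{il}-\delta_{il}\theta(j>k)(-1)^{\theta_{kl}}e_{kj}+\delta_{jk}\theta(i>l)e_{il}\bigr)L_i\bar L_k+L_j\bar L_l\bigl(-(q-q^{-1})\theta(k>j>l>i)(-1)^{\theta_j}e_{il}e_{kj}-\delta_{il}\theta(k>j)(-1)^{\theta_{ij}}e_{kj}+\delta_{jk}\theta(l>i)e_{il}\bigr).$ The Jacobson generators are the $H_i$ together with $a_i^-=e_{0i}$, $a_i^+=e_{i0}$, $i\in[1;n+m]$. The module: let $P$ be the subalgebra of $U_q[sl(n+1|m)]$ generated by all $H_i$, $L_i^{\pm1}$, all $[\![a_i^+,a_j^-]\!]$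 ($i\neq j\in[1;n+m]$) and all $a_i^-$. Let $\mathbb C|0\rangle$ be the one-dimensional $P$-module with $[\![a_i^-,a_j^+]\!]|0\rangle=0$ ($i\ne j$), $H_i|0\rangle=p|0\rangle$, $L_i^{\pm1}|0\rangle=q^{\pm p}|0\rangle$, $a_i^-|0\rangle=0$. Then $\bar W_p=\mathrm{Ind}_P^{U_q[sl(n+1|m)]}\mathbb C|0\rangle$; by the Poincaré-Birkhoff-Witt theorem it has the basis $$|p;r_1,\dots,r_{n+m}\rangle=(a_1^+)^{r_1}(a_2^+)^{r_2}\cdots(a_{n+m}^+)^{r_{n+m}}|0\rangle,$$ with $r_i\in\mathbb Z_{\ge0}$ for $i\in[1;n]$ and $r_i\in\{0,1\}$ for $i\in[n+1;n+m]$. Terms whose scalar coefficient vanishes (e.g. $[r_i]=0$ or $1-\theta_ir_i=0$) are read as zero. *)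

theory Defs
  imports Complex_Main "HOL-Algebra.Algebra"
begin

section \<open>Free associative algebras\<close>

text \<open>Words form a monoid, written additively so that the convolution product of
  \<^typ>\<open>'a \<Rightarrow>\<^sub>0 complex\<close> is the product of the free algebra.\<close>

datatype 'g free_monoid = Word (letters: "'g list")

instantiation free_monoid :: (type) monoid_add
begin
definition zero_free_monoid :: "'a free_monoid" where "0 = Word []"
definition plus_free_monoid :: "'a free_monoid \<Rightarrow> 'a free_monoid \<Rightarrow> 'a free_monoid"
  where "u + v = Word (letters u @ letters v)"
instance
  by intro_classes (simp_all add: zero_free_monoid_def plus_free_monoid_def)
end

type_synonym 'g free_alg = "'g free_monoid \<Rightarrow>\<^sub>0 complex"

definition free_algebra :: "'g set \<Rightarrow> 'g free_alg ring" where
  "free_algebra S =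
     \<lparr>carrier = {f. \<forall>w \<in> Poly_Mapping.keys f. set (letters w) \<subseteq> S},
      monoid.mult = (*), one = 1, ring.zero = 0, ring.add = (+)\<rparr>"

definition scal :: "complex \<Rightarrow> 'g free_alg" where
  "scal c = Poly_Mapping.single 0 c"

definition gvar :: "'g \<Rightarrow> 'g free_alg" where
  "gvar g = Poly_Mapping.single (Word [g]) 1"


section \<open>The quantum superalgebra $U_q[sl(n+1|m)]$\<close>

text \<open>Throughout, $q^x$ is \<^term>\<open>exp (h * x)\<close>. The generator $L_i = q^{H_i}$ is a symbol of its
  own, tied to $H_i$ by the relations. \<^term>\<open>Egen i j\<close> stands for $e_{ij}$.\<close>

datatype gen = Hgen nat | Lgen nat | Linv nat | Egen nat nat

definition cartan_gens :: "nat \<Rightarrow> nat \<Rightarrow> gen set" where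
  "cartan_gens n m = Hgen ` {1..n+m} \<union> Lgen ` {1..n+m} \<union> Linv ` {1..n+m}"

definition gens :: "nat \<Rightarrow> nat \<Rightarrow> gen set" where
  "gens n m = cartan_gens n m \<union> {Egen i j | i j. i \<le> n+m \<and> j \<le> n+m \<and> i \<noteq> j}"

definition \<theta> :: "nat \<Rightarrow> nat \<Rightarrow> nat" where
  "\<theta> n i = (if i \<le> n then 0 else 1)"

definition \<theta>2 :: "nat \<Rightarrow> nat \<Rightarrow> nat \<Rightarrow> nat" where
  "\<theta>2 n i j = (\<theta> n i + \<theta> n j) mod 2"

fun gdeg :: "nat \<Rightarrow> gen \<Rightarrow> nat" where
  "gdeg n (Egen i j) = \<theta>2 n i j"
| "gdeg n _ = 0"

text \<open>The bracket $[\![g, g']\!]_x$ of two (homogeneous) generators.\<close>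

definition sbr :: "nat \<Rightarrow> complex \<Rightarrow> gen \<Rightarrow> gen \<Rightarrow> gen free_alg" where
  "sbr n x g g' = gvar g * gvar g' - scal ((-1) ^ (gdeg n g * gdeg n g') * x) * (gvar g' * gvar g)"

definition Lel :: "nat \<Rightarrow> gen free_alg" where
  "Lel i = (if i = 0 then 1 else gvar (Lgen i))"

definition Lbar :: "nat \<Rightarrow> gen free_alg" where
  "Lbar i = (if i = 0 then 1 else gvar (Linv i))"

text \<open>$L_j^{(-1)^{\theta_i}}$ and $\bar L_j^{(-1)^{\theta_i}}$:\<close>

definition Lsgn :: "nat \<Rightarrow> nat \<Rightarrow> nat \<Rightarrow> gen free_alg" where
  "Lsgn n i j = (if \<theta> n i = 0 then Lel j else Lbar j)"

definition Lbarsgn :: "nat \<Rightarrow> nat \<Rightarrow> nat \<Rightarrow> gen free_alg" where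
  "Lbarsgn n i j = (if \<theta> n i = 0 then Lbar j else Lel j)"

definition \<delta> :: "nat \<Rightarrow> nat \<Rightarrow> complex" where
  "\<delta> i j = of_bool (i = j)"

definition qdiff :: "complex \<Rightarrow> complex" where
  "qdiff h = exp h - exp (- h)"

definition qnum :: "complex \<Rightarrow> complex \<Rightarrow> complex" where
  "qnum h x = (exp (h * x) - exp (- (h * x))) / qdiff h"

definition root_less :: "nat \<Rightarrow> nat \<Rightarrow> nat \<Rightarrow> nat \<Rightarrow> bool" where
  "root_less i j k l \<longleftrightarrow> i < k \<or> (i = k \<and> j < l)"

definition weight :: "nat \<Rightarrow> nat \<Rightarrow> nat \<Rightarrow> nat \<Rightarrow> complex" where
  "weight n i j k = \<delta> 0 j - \<delta> 0 k - (-1) ^ \<theta> n i * (\<delta> i j - \<delta> i k)"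

text \<open>Each relation $a = b$ is given as the element $a - b$ of the free algebra. A symbol
  \<^term>\<open>Egen i i\<close>, which is not a generator, only ever occurs below with coefficient $0$.\<close>

definition cartan_rels :: "nat \<Rightarrow> nat \<Rightarrow> complex \<Rightarrow> gen free_alg set" where
  "cartan_rels n m h =
     {gvar a * gvar b - gvar b * gvar a | a b. a \<in> cartan_gens n m \<and> b \<in> cartan_gens n m}
   \<union> {gvar (Lgen i) * gvar (Linv i) - 1 | i. i \<in> {1..n+m}}
   \<union> {gvar (Hgen i) * gvar (Egen j k) - gvar (Egen j k) * gvar (Hgen i)
        - scal (weight n i j k) * gvar (Egen j k)
      | i j k. i \<in> {1..n+m} \<and> j \<le> n+m \<and> k \<le> n+m \<and> j \<noteq> k}
   \<union> {gvar (Lgen i) * gvar (Egen j k)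
        - scal (exp (h * weight n i j k)) * (gvar (Egen j k) * gvar (Lgen i))
      | i j k. i \<in> {1..n+m} \<and> j \<le> n+m \<and> k \<le> n+m \<and> j \<noteq> k}
   \<union> {gvar (Egen i j) * gvar (Egen i j)
      | i j. i \<le> n+m \<and> j \<le> n+m \<and> i \<noteq> j \<and> \<theta>2 n i j = 1}"

definition pos_rels :: "nat \<Rightarrow> nat \<Rightarrow> complex \<Rightarrow> gen free_alg set" where
  "pos_rels n m h =
     {sbr n (exp (h * ((-1) ^ \<theta> n j * \<delta> j l - (-1) ^ \<theta> n j * \<delta> j k + (-1) ^ \<theta> n i * \<delta> i k)))
          (Egen i j) (Egen k l)
      - (scal (\<delta> j k) * gvar (Egen i l)
         + scal (qdiff h * (-1) ^ \<theta> n k * of_bool (l > j \<and> j > k \<and> k > i))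
             * (gvar (Egen k j) * gvar (Egen i l)))
      | i j k l. j \<le> n+m \<and> l \<le> n+m \<and> i < j \<and> k < l \<and> root_less i j k l}"

definition neg_rels :: "nat \<Rightarrow> nat \<Rightarrow> complex \<Rightarrow> gen free_alg set" where
  "neg_rels n m h =
     {sbr n (exp (h * (- ((-1) ^ \<theta> n j * \<delta> j l) + (-1) ^ \<theta> n j * \<delta> j k - (-1) ^ \<theta> n i * \<delta> i k)))
          (Egen i j) (Egen k l)
      - (scal (\<delta> j k) * gvar (Egen i l)
         - scal (qdiff h * (-1) ^ \<theta> n k * of_bool (i > k \<and> k > j \<and> j > l))
             * (gvar (Egen k j) * gvar (Egen i l)))
      | i j k l. i \<le> n+m \<and> k \<le> n+m \<and> i > j \<and> k > l \<and> root_less k l i j}"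

definition mixed_rels :: "nat \<Rightarrow> nat \<Rightarrow> complex \<Rightarrow> gen free_alg set" where
  "mixed_rels n m h =
     {sbr n 1 (Egen i j) (Egen k l)
      - (scal (\<delta> i l * \<delta> j k / qdiff h)
           * (Lsgn n i j * Lbarsgn n i i - Lbarsgn n i j * Lsgn n i i)
         + (scal (qdiff h * of_bool (j > k \<and> k > i \<and> i > l) * (-1) ^ \<theta> n k)
               * (gvar (Egen k j) * gvar (Egen i l))
            - scal (\<delta> i l * of_bool (j > k) * (-1) ^ \<theta>2 n k l) * gvar (Egen k j)
            + scal (\<delta> j k * of_bool (i > l)) * gvar (Egen i l)) * (Lel i * Lbar k)
         + (Lel j * Lbar l)
           * (- (scal (qdiff h * of_bool (k > j \<and> j > l \<and> l > i) * (-1) ^ \<theta> n j)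
                   * (gvar (Egen i l) * gvar (Egen k j)))
              - scal (\<delta> i l * of_bool (k > j) * (-1) ^ \<theta>2 n i j) * gvar (Egen k j)
              + scal (\<delta> j k * of_bool (l > i)) * gvar (Egen i l)))
      | i j k l. j \<le> n+m \<and> k \<le> n+m \<and> i < j \<and> k > l}"

definition Uq_ideal :: "nat \<Rightarrow> nat \<Rightarrow> complex \<Rightarrow> gen free_alg set" where
  "Uq_ideal n m h = genideal (free_algebra (gens n m))
     (cartan_rels n m h \<union> pos_rels n m h \<union> neg_rels n m h \<union> mixed_rels n m h)"

definition Uq :: "nat \<Rightarrow> nat \<Rightarrow> complex \<Rightarrow> gen free_alg set ring" where
  "Uq n m h = free_algebra (gens n m) Quot Uq_ideal n m h"

definition Uq_class :: "nat \<Rightarrow> nat \<Rightarrow> complex \<Rightarrow> gen free_alg \<Rightarrow> gen free_alg set" where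
  "Uq_class n m h f = Uq_ideal n m h +>\<^bsub>free_algebra (gens n m)\<^esub> f"

definition H_op :: "nat \<Rightarrow> nat \<Rightarrow> complex \<Rightarrow> nat \<Rightarrow> gen free_alg set" where
  "H_op n m h i = Uq_class n m h (gvar (Hgen i))"

definition jac_minus :: "nat \<Rightarrow> nat \<Rightarrow> complex \<Rightarrow> nat \<Rightarrow> gen free_alg set" where
  "jac_minus n m h i = Uq_class n m h (gvar (Egen 0 i))"

definition jac_plus :: "nat \<Rightarrow> nat \<Rightarrow> complex \<Rightarrow> nat \<Rightarrow> gen free_alg set" where
  "jac_plus n m h i = Uq_class n m h (gvar (Egen i 0))"


section \<open>Induced modules\<close>

definition left_module :: "('a, 'b) ring_scheme \<Rightarrow> ('a \<Rightarrow> 'v \<Rightarrow> 'v::ab_group_add) \<Rightarrow> bool" where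
  "left_module R act \<longleftrightarrow>
     (\<forall>v. act \<one>\<^bsub>R\<^esub> v = v) \<and>
     (\<forall>x \<in> carrier R. \<forall>v w. act x (v + w) = act x v + act x w) \<and>
     (\<forall>x \<in> carrier R. \<forall>y \<in> carrier R. \<forall>v. act (x \<oplus>\<^bsub>R\<^esub> y) v = act x v + act y v) \<and>
     (\<forall>x \<in> carrier R. \<forall>y \<in> carrier R. \<forall>v. act (x \<otimes>\<^bsub>R\<^esub> y) v = act x (act y v))"

text \<open>For a ring \<open>R\<close>, a subring \<open>P\<close> and a left \<open>P\<close>-module \<open>V\<close> (all of type \<open>'v\<close>), the induced module
  is $R \otimes_P V$: the free abelian group on $R \times V$ modulo biadditivity and
  $xs \otimes v = x \otimes sv$ for $s \in P$, with $R$ acting by left multiplication.\<close>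

definition pair_group :: "('a, 'b) ring_scheme \<Rightarrow> (('a \<times> 'v) \<Rightarrow>\<^sub>0 int) monoid" where
  "pair_group R = free_Abelian_group (carrier R \<times> UNIV)"

definition tensor_rels ::
  "('a, 'b) ring_scheme \<Rightarrow> 'a set \<Rightarrow> ('a \<Rightarrow> 'v \<Rightarrow> 'v::ab_group_add) \<Rightarrow> (('a \<times> 'v) \<Rightarrow>\<^sub>0 int) set"
  where
  "tensor_rels R P act = generate (pair_group R)
     ({frag_of (x \<oplus>\<^bsub>R\<^esub> y, v) - frag_of (x, v) - frag_of (y, v)
        | x y v. x \<in> carrier R \<and> y \<in> carrier R}
    \<union> {frag_of (x, v + w) - frag_of (x, v) - frag_of (x, w) | x v w. x \<in> carrier R}
    \<union> {frag_of (x \<otimes>\<^bsub>R\<^esub> s, v) - frag_of (x, act s v) | x s v. x \<in> carrier R \<and> s \<in> P})"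

definition induced_module ::
  "('a, 'b) ring_scheme \<Rightarrow> 'a set \<Rightarrow> ('a \<Rightarrow> 'v \<Rightarrow> 'v::ab_group_add) \<Rightarrow> (('a \<times> 'v) \<Rightarrow>\<^sub>0 int) set monoid"
  where
  "induced_module R P act = pair_group R Mod tensor_rels R P act"

definition tensor ::
  "('a, 'b) ring_scheme \<Rightarrow> 'a set \<Rightarrow> ('a \<Rightarrow> 'v \<Rightarrow> 'v::ab_group_add) \<Rightarrow> 'a \<Rightarrow> 'v \<Rightarrow> (('a \<times> 'v) \<Rightarrow>\<^sub>0 int) set"
  where
  "tensor R P act x v = tensor_rels R P act #>\<^bsub>pair_group R\<^esub> frag_of (x, v)"

text \<open>The action on cosets is defined through arbitrary representatives, as for
  \<^const>\<open>rcoset_mult\<close>.\<close>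

definition induced_action ::
  "('a, 'b) ring_scheme \<Rightarrow> 'a set \<Rightarrow> ('a \<Rightarrow> 'v \<Rightarrow> 'v::ab_group_add) \<Rightarrow> 'a
     \<Rightarrow> (('a \<times> 'v) \<Rightarrow>\<^sub>0 int) set \<Rightarrow> (('a \<times> 'v) \<Rightarrow>\<^sub>0 int) set"
  where
  "induced_action R P act y w =
     (\<Union>f \<in> w. tensor_rels R P act #>\<^bsub>pair_group R\<^esub>
               frag_extend (\<lambda>(x, v). frag_of (y \<otimes>\<^bsub>R\<^esub> x, v)) f)"


section \<open>The module $\bar W_p$\<close>

text \<open>A subalgebra is a subring containing the scalars. Here $a_i^+$ is \<^term>\<open>Egen i 0\<close> and
  $a_i^-$ is \<^term>\<open>Egen 0 i\<close>.\<close>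

definition P_alg :: "nat \<Rightarrow> nat \<Rightarrow> complex \<Rightarrow> gen free_alg set set" where
  "P_alg n m h = generate_ring (Uq n m h) (Uq_class n m h `
     (range scal
      \<union> gvar ` cartan_gens n m
      \<union> {sbr n 1 (Egen i 0) (Egen 0 j) | i j. i \<in> {1..n+m} \<and> j \<in> {1..n+m} \<and> i \<noteq> j}
      \<union> {gvar (Egen 0 i) | i. i \<in> {1..n+m}}))"

text \<open>\<open>act\<close> is the action of \<^const>\<open>P_alg\<close> on the complex line, whose element $1$ is $|0\rangle$.
  Values of \<open>act\<close> outside \<^const>\<open>P_alg\<close> are irrelevant.\<close>

definition vacuum_module ::
  "nat \<Rightarrow> nat \<Rightarrow> complex \<Rightarrow> complex \<Rightarrow> (gen free_alg set \<Rightarrow> complex \<Rightarrow> complex) \<Rightarrow> bool" where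
  "vacuum_module n m h p act \<longleftrightarrow>
     left_module (Uq n m h\<lparr>carrier := P_alg n m h\<rparr>) act \<and>
     (\<forall>c v. act (Uq_class n m h (scal c)) v = c * v) \<and>
     (\<forall>i \<in> {1..n+m}. \<forall>j \<in> {1..n+m}. i \<noteq> j \<longrightarrow>
        act (Uq_class n m h (sbr n 1 (Egen 0 i) (Egen j 0))) 1 = 0) \<and>
     (\<forall>i \<in> {1..n+m}.
        act (H_op n m h i) 1 = p \<and>
        act (Uq_class n m h (gvar (Lgen i))) 1 = exp (h * p) \<and>
        act (Uq_class n m h (gvar (Linv i))) 1 = exp (- (h * p)) \<and>
        act (jac_minus n m h i) 1 = 0)"

type_synonym W_elem = "((gen free_alg set \<times> complex) \<Rightarrow>\<^sub>0 int) set"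

definition W_act ::
  "nat \<Rightarrow> nat \<Rightarrow> complex \<Rightarrow> (gen free_alg set \<Rightarrow> complex \<Rightarrow> complex)
     \<Rightarrow> gen free_alg set \<Rightarrow> W_elem \<Rightarrow> W_elem" where
  "W_act n m h act = induced_action (Uq n m h) (P_alg n m h) act"

text \<open>The complex vector space structure of the module comes from the scalars in the algebra.\<close>

definition W_scale ::
  "nat \<Rightarrow> nat \<Rightarrow> complex \<Rightarrow> (gen free_alg set \<Rightarrow> complex \<Rightarrow> complex)
     \<Rightarrow> complex \<Rightarrow> W_elem \<Rightarrow> W_elem" where
  "W_scale n m h act c = W_act n m h act (Uq_class n m h (scal c))"

definition W_vacuum ::
  "nat \<Rightarrow> nat \<Rightarrow> complex \<Rightarrow> (gen free_alg set \<Rightarrow> complex \<Rightarrow> complex) \<Rightarrow> W_elem" where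
  "W_vacuum n m h act = tensor (Uq n m h) (P_alg n m h) act \<one>\<^bsub>Uq n m h\<^esub> 1"

definition basis_labels :: "nat \<Rightarrow> nat \<Rightarrow> (nat \<Rightarrow> nat) set" where
  "basis_labels n m = {r. \<forall>i \<in> {n+1..n+m}. r i \<in> {0, 1}}"

text \<open>$|p; r_1, \dots, r_{n+m}\rangle = (a_1^+)^{r_1} \cdots (a_{n+m}^+)^{r_{n+m}} |0\rangle$;
  only the values of \<open>r\<close> on $1, \dots, n+m$ enter. The vector makes sense for every \<open>r\<close>, so
  that a term with a vanishing coefficient is zero whatever its label.\<close>

definition W_vec ::
  "nat \<Rightarrow> nat \<Rightarrow> complex \<Rightarrow> (gen free_alg set \<Rightarrow> complex \<Rightarrow> complex) \<Rightarrow> (nat \<Rightarrow> nat) \<Rightarrow> W_elem" where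
  "W_vec n m h act r = W_act n m h act
     (foldr (\<lambda>i x. (jac_plus n m h i [^]\<^bsub>Uq n m h\<^esub> r i) \<otimes>\<^bsub>Uq n m h\<^esub> x) [1..<n+m+1] \<one>\<^bsub>Uq n m h\<^esub>)
     (W_vacuum n m h act)"

end

theory Submission
  imports Defs
begin

text \<open>A vector $x \otimes |0\rangle$ of $\bar W_p$ vanishes as soon as $x$ lies in the annihilator of the
  vacuum, so everything happens modulo a left ideal of the free algebra. Call a vector \<open>i\<close>-null if it
  is killed by $a_i^-$ and by all $e_{ki}$, $k \ne i$. By the relations, \<open>i\<close>-null vectors are
  stable under $a_l^+$ for all $l \ne i$, in whatever order these act, and $|0\rangle$ is \<open>i\<close>-null. Since
  the $a_j^+$ commute up to a scalar, $|p;r\rangle$ is a multiple of $(a_i^+)^{r_i} w$ with $w$ an \<open>i\<close>-null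
  weight vector, and the action of $a_i^-$ becomes a computation in $U_q[sl(2)]$ or
  $U_q[gl(1|1)]$. Linear independence of the monomials is never needed.\<close>

section \<open>The free algebra\<close>

text \<open>Two vectors x|0> and y|0> agree as soon as x - y annihilates |0>. The annihilator is
  only a left ideal: a congruence may be multiplied from the left, not from the right. The defining
  relations lie in a two-sided ideal and may be used with any factor behind them. Hence every
  commutation rule carries an arbitrary trailing \<open>w\<close>, while facts special to the vacuum
  are used only next to it. Nullity is demanded of the whole column e_{ki} because only the column
  closes up: a_i^- a_l^+ produces e_{li} with a Cartan factor, and e_{ki} a_l^+ produces e_{li}
  a_k^+ when l lies strictly between k and i. There k is not between l and i, so e_{li} and a_k^+
  commute up to a sign and the process stops. The positive exponent in q^{r_1+...+r_{i-1}} for a_i^-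
  arises because r_i factors a_i^+ are pulled to the front and r_i - 1 are put back, which leaves
  the inverse of one exchange factor.\<close>

lemma scal_0 [simp]: "scal 0 = 0" and scal_1 [simp]: "scal 1 = 1"
  by (simp_all add: scal_def)

lemma scal_add: "scal (a + b) = scal a + scal b"
  by (simp add: scal_def single_add)

lemma scal_mult: "scal a * scal b = scal (a * b)"
  by (simp add: scal_def mult_single)

lemma scal_mult_left [simp]: "scal a * (scal b * f) = scal (a * b) * f"
  by (simp add: scal_mult flip: mult.assoc)

lemma scal_uminus: "scal (- a) = - scal a"
  by (simp add: scal_def single_uminus)

lemma scal_diff: "scal (a - b) = scal a - scal b"
  by (simp add: scal_def single_diff)

text \<open>\<open>scal c\<close> is supported on the empty word, the unit of the word monoid, and
  coefficients commute; adding one monomial at a time reduces centrality to this case.\<close>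

lemma scal_commute: "f * scal c = scal c * f"
proof (induction f rule: Poly_Mapping.update_induct)
  case (update f a b)
  have "Poly_Mapping.update a b f = Poly_Mapping.single a b + f"
    using update(1) by (intro poly_mapping_eqI)
      (auto simp: lookup_update lookup_add lookup_single in_keys_iff)
  then show ?case using update(3)
    by (simp add: distrib_left distrib_right) (simp add: scal_def mult_single mult.commute)
qed simp

lemma scal_left_commute: "f * (scal c * g) = scal c * (f * g)"
  by (metis mult.assoc scal_commute)

lemma gvar_scal [simp]:
  "gvar g * (scal c * f) = scal c * (gvar g * f)"
  "gvar g ^ t * (scal c * f) = scal c * (gvar g ^ t * f)"
  by (rule scal_left_commute)+

lemma carrier_free_algebra:
  "carrier (free_algebra S) = {f. \<forall>w \<in> Poly_Mapping.keys f. set (letters w) \<subseteq> S}"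
  by (simp add: free_algebra_def)

lemma free_algebra_closed [simp, intro]:
  "0 \<in> carrier (free_algebra S)" "1 \<in> carrier (free_algebra S)" "scal c \<in> carrier (free_algebra S)"
  "g \<in> S \<Longrightarrow> gvar g \<in> carrier (free_algebra S)"
  by (auto simp: carrier_free_algebra scal_def gvar_def zero_free_monoid_def simp flip: single_one split: if_splits)

lemma free_algebra_closed_op [simp, intro]:
  assumes "f \<in> carrier (free_algebra S)"
  shows "- f \<in> carrier (free_algebra S)"
    and "g \<in> carrier (free_algebra S) \<Longrightarrow> f + g \<in> carrier (free_algebra S)"
    and "g \<in> carrier (free_algebra S) \<Longrightarrow> f - g \<in> carrier (free_algebra S)"
    and "g \<in> carrier (free_algebra S) \<Longrightarrow> f * g \<in> carrier (free_algebra S)"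
proof -
  show *: "- f \<in> carrier (free_algebra S)"
    using assms by (simp add: carrier_free_algebra keys_minus)
  show **: "f + g \<in> carrier (free_algebra S)" if "g \<in> carrier (free_algebra S)" for g
    using assms that Poly_Mapping.keys_add[of f g] by (auto simp: carrier_free_algebra)
  show "f - g \<in> carrier (free_algebra S)" if "g \<in> carrier (free_algebra S)"
    using that keys_diff[of f g] assms by (auto simp: carrier_free_algebra)
  show "f * g \<in> carrier (free_algebra S)" if "g \<in> carrier (free_algebra S)"
    using assms that Poly_Mapping.keys_mult[of f g]
    by (fastforce simp: carrier_free_algebra plus_free_monoid_def)
qed

lemma free_algebra_closed_power [simp, intro]:
  "f \<in> carrier (free_algebra S) \<Longrightarrow> f ^ k \<in> carrier (free_algebra S)"
  by (induction k) auto

text \<open>Membership of \<open>f\<close> is asked for only when \<open>c\<close> is nonzero,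
  because the relations contain symbols \<open>Egen i i\<close> outside the carrier, always with a
  vanishing coefficient.\<close>

lemma scal_mult_closed:
  "(c \<noteq> 0 \<Longrightarrow> f \<in> carrier (free_algebra S)) \<Longrightarrow> scal c * f \<in> carrier (free_algebra S)"
  by (cases "c = 0") auto

lemma free_algebra_simps [simp]:
  "monoid.mult (free_algebra S) = (*)" "monoid.one (free_algebra S) = 1"
  "ring.zero (free_algebra S) = 0" "ring.add (free_algebra S) = (+)"
  by (simp_all add: free_algebra_def)

lemma ring_free_algebra: "ring (free_algebra S)"
proof (rule ringI)
  show "abelian_group (free_algebra S)"
  proof (rule abelian_groupI)
    show "\<exists>y\<in>carrier (free_algebra S). y \<oplus>\<^bsub>free_algebra S\<^esub> x = \<zero>\<^bsub>free_algebra S\<^esub>"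
      if "x \<in> carrier (free_algebra S)" for x
      using that by (intro bexI[of _ "- x"]) auto
  qed (auto simp: add.assoc add.commute)
  show "Group.monoid (free_algebra S)"
    by (rule monoidI) (auto simp: mult.assoc)
qed (auto simp: distrib_left distrib_right)

section \<open>Calculus modulo the annihilator of the vacuum\<close>

lemma \<theta>_0 [simp]: "\<theta> n 0 = 0"
  by (simp add: \<theta>_def)

lemma \<theta>2_0 [simp]: "\<theta>2 n i 0 = \<theta> n i" "\<theta>2 n 0 i = \<theta> n i"
  by (simp_all add: \<theta>2_def \<theta>_def)

lemma weight_plus: "1 \<le> i \<Longrightarrow> 1 \<le> j \<Longrightarrow> weight n i j 0 = - 1 - (-1) ^ \<theta> n i * of_bool (i = j)"
  by (auto simp: weight_def \<delta>_def)

lemma qnum_0 [simp]: "qnum h 0 = 0"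
  by (simp add: qnum_def)

lemma sum_list_upt: "sum_list (map f [a..<b]) = (\<Sum>j=a..<b. f j)" for f :: "nat \<Rightarrow> 'b::comm_monoid_add"
  using sum.distinct_set_conv_list[of "[a..<b]" f] by simp

lemma prod_list_upt: "prod_list (map f [a..<b]) = (\<Prod>j=a..<b. f j)" for f :: "nat \<Rightarrow> 'b::comm_monoid_mult"
  using prod.distinct_set_conv_list[of "[a..<b]" f] by simp

text \<open>Abstracting \<open>K\<close> keeps the cosets of the induced module out of the
  calculation; the instance is \<open>vac_ann\<close>. \<open>K_mult\<close> puts factors in front
  of an element of \<open>K\<close>, whereas \<open>K_rel\<close> puts one behind a
  relation.\<close>

locale vacuum_ideal =
  fixes n m :: nat and h p :: complex and K :: "gen free_alg set"
  assumes K_zero: "0 \<in> K"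
    and K_add: "f \<in> K \<Longrightarrow> g \<in> K \<Longrightarrow> f + g \<in> K"
    and K_mult: "x \<in> carrier (free_algebra (gens n m)) \<Longrightarrow> f \<in> K \<Longrightarrow> x * f \<in> K"
    and K_rel: "u \<in> cartan_rels n m h \<union> pos_rels n m h \<union> neg_rels n m h \<union> mixed_rels n m h
       \<Longrightarrow> x \<in> carrier (free_algebra (gens n m)) \<Longrightarrow> u * x \<in> K"
    and K_H: "i \<in> {1..n+m} \<Longrightarrow> gvar (Hgen i) - scal p \<in> K"
    and K_L: "i \<in> {1..n+m} \<Longrightarrow> gvar (Lgen i) - scal (exp (h * p)) \<in> K"
    and K_Linv: "i \<in> {1..n+m} \<Longrightarrow> gvar (Linv i) - scal (exp (- (h * p))) \<in> K"
    and K_minus: "i \<in> {1..n+m} \<Longrightarrow> gvar (Egen 0 i) \<in> K"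
    and K_sbr: "i \<in> {1..n+m} \<Longrightarrow> j \<in> {1..n+m} \<Longrightarrow> i \<noteq> j \<Longrightarrow>
       sbr n 1 (Egen 0 i) (Egen j 0) \<in> K"
begin

abbreviation C where "C \<equiv> carrier (free_algebra (gens n m))"
abbreviation E where "E i j \<equiv> gvar (Egen i j)"
abbreviation L where "L i \<equiv> gvar (Lgen i)"
abbreviation L' where "L' i \<equiv> gvar (Linv i)"

definition eqv :: "gen free_alg \<Rightarrow> gen free_alg \<Rightarrow> bool" (infix "=\<^sub>K" 50)
  where "f =\<^sub>K g \<longleftrightarrow> f - g \<in> K"

lemma E_C [simp]: "i \<le> n+m \<Longrightarrow> j \<le> n+m \<Longrightarrow> i \<noteq> j \<Longrightarrow> E i j \<in> C"
  by (rule free_algebra_closed) (auto simp: gens_def)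

lemma cartan_C [simp]:
  assumes "1 \<le> i" "i \<le> n+m"
  shows "gvar (Hgen i) \<in> C" "L i \<in> C" "L' i \<in> C"
  using assms by (auto intro!: free_algebra_closed(4) simp: gens_def cartan_gens_def)

lemma K_scal: "f \<in> K \<Longrightarrow> scal c * f \<in> K"
  by (rule K_mult) auto

lemma K_uminus: "f \<in> K \<Longrightarrow> - f \<in> K"
  using K_scal[of f "-1"] by (simp add: scal_uminus)

lemma K_diff: "f \<in> K \<Longrightarrow> g \<in> K \<Longrightarrow> f - g \<in> K"
  using K_add[of f "- g"] K_uminus by simp

lemma eqv_refl [simp]: "f =\<^sub>K f"
  by (simp add: eqv_def K_zero)

lemma eqv_sym: "f =\<^sub>K g \<Longrightarrow> g =\<^sub>K f"
  unfolding eqv_def by (metis K_uminus minus_diff_eq)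

lemma eqv_trans [trans]: "f =\<^sub>K g \<Longrightarrow> g =\<^sub>K k \<Longrightarrow> f =\<^sub>K k"
  unfolding eqv_def using K_add[of "f - g" "g - k"] by simp

lemma eqv_add: "f =\<^sub>K f' \<Longrightarrow> g =\<^sub>K g' \<Longrightarrow> f + g =\<^sub>K f' + g'"
  unfolding eqv_def using K_add[of "f - f'" "g - g'"] by (simp add: algebra_simps)

lemma eqv_diff: "f =\<^sub>K f' \<Longrightarrow> g =\<^sub>K g' \<Longrightarrow> f - g =\<^sub>K f' - g'"
  unfolding eqv_def using K_diff[of "f - f'" "g - g'"] by (simp add: algebra_simps)

lemma eqv_mult: "x \<in> C \<Longrightarrow> f =\<^sub>K g \<Longrightarrow> x * f =\<^sub>K x * g"
  unfolding eqv_def using K_mult[of x "f - g"] by (simp add: algebra_simps)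

lemma eqv_scal: "f =\<^sub>K g \<Longrightarrow> scal c * f =\<^sub>K scal c * g"
  by (rule eqv_mult) auto

lemma eqv_K: "f =\<^sub>K g \<Longrightarrow> g \<in> K \<Longrightarrow> f \<in> K"
  unfolding eqv_def using K_add[of "f - g" g] by simp

lemma K_iff_eqv: "f \<in> K \<longleftrightarrow> f =\<^sub>K 0"
  by (simp add: eqv_def)

section \<open>Commutation rules modulo the annihilator\<close>

text \<open>Turns a bracket relation into a rewriting rule in front of \<open>w\<close>; the rules
  that follow pick the indices and evaluate the Kronecker deltas.\<close>

lemma sbr_rel:
  assumes "sbr n x g g' - R \<in> cartan_rels n m h \<union> pos_rels n m h \<union> neg_rels n m h \<union> mixed_rels n m h"
    and "w \<in> C"
  shows "gvar g * (gvar g' * w) =\<^sub>K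
     scal ((-1) ^ (gdeg n g * gdeg n g') * x) * (gvar g' * (gvar g * w)) + R * w"
  using K_rel[OF assms] unfolding eqv_def by (simp add: sbr_def algebra_simps)

text \<open>The factor q^-1 comes from the common second index 0 of the two negative root vectors,
  where \<open>\<theta> n 0 = 0\<close>.\<close>

lemma plus_plus:
  assumes "1 \<le> k" "k < i" "i \<le> n+m" "w \<in> C"
  shows "E i 0 * (E k 0 * w) =\<^sub>K scal ((-1) ^ (\<theta> n i * \<theta> n k) * exp (- h)) * (E k 0 * (E i 0 * w))"
proof -
  have "sbr n (exp (- h)) (Egen i 0) (Egen k 0) - 0 \<in> neg_rels n m h"
    unfolding neg_rels_def mem_Collect_eq using assms
    by (intro exI[of _ i] exI[of _ 0] exI[of _ k])
       (simp add: \<delta>_def root_less_def)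
  then show ?thesis using assms sbr_rel[of "exp (- h)" "Egen i 0" "Egen k 0" 0 w]
    by simp
qed

lemma minus_plus_same:
  assumes "1 \<le> i" "i \<le> n+m" "w \<in> C"
  shows "E 0 i * (E i 0 * w) =\<^sub>K scal ((-1) ^ \<theta> n i) * (E i 0 * (E 0 i * w))
           + scal (1 / qdiff h) * (L i * w - L' i * w)"
proof -
  have s: "\<theta> n i * \<theta> n i = \<theta> n i" by (simp add: \<theta>_def)
  have "sbr n 1 (Egen 0 i) (Egen i 0) - scal (1 / qdiff h) * (L i - L' i) \<in> mixed_rels n m h"
    unfolding mixed_rels_def mem_Collect_eq using assms
    by (intro exI[of _ 0] exI[of _ i])
       (simp add: \<delta>_def Lsgn_def Lbarsgn_def Lel_def Lbar_def)
  then show ?thesis using assms sbr_rel[of 1 "Egen 0 i" "Egen i 0" "scal (1 / qdiff h) * (L i - L' i)" w]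
    by (simp add: s algebra_simps)
qed

text \<open>The bracket leaves e_{ki} behind, which is why these root vectors have to be tracked.
  For k < i the Cartan factor stands to the right of e_{ki}; for k > i, in the next rule, it stands
  to the left.\<close>

lemma minus_plus_less:
  assumes "1 \<le> k" "k < i" "i \<le> n+m" "w \<in> C"
  shows "E 0 i * (E k 0 * w) =\<^sub>K scal ((-1) ^ (\<theta> n i * \<theta> n k)) * (E k 0 * (E 0 i * w))
           - scal ((-1) ^ \<theta> n k) * (E k i * (L' k * w))"
proof -
  have "sbr n 1 (Egen 0 i) (Egen k 0) - (- scal ((-1) ^ \<theta> n k) * E k i) * L' k \<in> mixed_rels n m h"
    unfolding mixed_rels_def mem_Collect_eq using assms
    by (intro exI[of _ 0] exI[of _ i] exI[of _ k])
       (simp add: \<delta>_def Lel_def Lbar_def)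
  then show ?thesis
    using assms sbr_rel[of 1 "Egen 0 i" "Egen k 0" "(- scal ((-1) ^ \<theta> n k) * E k i) * L' k" w]
    by (simp add: algebra_simps)
qed

lemma minus_plus_greater:
  assumes "1 \<le> i" "i < k" "k \<le> n+m" "w \<in> C"
  shows "E 0 i * (E k 0 * w) =\<^sub>K scal ((-1) ^ (\<theta> n i * \<theta> n k)) * (E k 0 * (E 0 i * w))
           - scal ((-1) ^ \<theta> n i) * (L i * (E k i * w))"
proof -
  have "sbr n 1 (Egen 0 i) (Egen k 0) - L i * (- scal ((-1) ^ \<theta> n i) * E k i) \<in> mixed_rels n m h"
    unfolding mixed_rels_def mem_Collect_eq using assms
    by (intro exI[of _ 0] exI[of _ i] exI[of _ k])
       (simp add: \<delta>_def Lel_def Lbar_def)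
  then show ?thesis
    using assms sbr_rel[of 1 "Egen 0 i" "Egen k 0" "L i * (- scal ((-1) ^ \<theta> n i) * E k i)" w]
    by (simp add: algebra_simps)
qed

text \<open>The value l = i is excluded because it would add a term in e_{k0}, which lies outside
  column i.\<close>

lemma pos_plus:
  assumes "1 \<le> k" "k < i" "i \<le> n+m" "1 \<le> l" "l \<le> n+m" "l \<noteq> i" "w \<in> C"
  shows "E k i * (E l 0 * w) =\<^sub>K scal ((-1) ^ (\<theta>2 n k i * \<theta> n l)) * (E l 0 * (E k i * w))
     + scal (qdiff h * of_bool (k < l \<and> l < i) * (-1) ^ \<theta> n l) * (E l i * (E k 0 * (L k * (L' l * w))))"
proof -
  let ?R = "(scal (qdiff h * of_bool (k < l \<and> l < i) * (-1) ^ \<theta> n l) * (E l i * E k 0)) * (L k * L' l)"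
  have "sbr n 1 (Egen k i) (Egen l 0) - ?R \<in> mixed_rels n m h"
    unfolding mixed_rels_def mem_Collect_eq using assms
    by (intro exI[of _ k] exI[of _ i] exI[of _ l] exI[of _ 0])
       (simp add: \<delta>_def Lel_def Lbar_def)
  then show ?thesis
    using assms sbr_rel[of 1 "Egen k i" "Egen l 0" ?R w]
    by (simp add: algebra_simps)
qed

text \<open>The scalar depends on the parities and on whether l = k. It is left existential because
  the rule only serves to prove membership in \<open>K\<close>.\<close>

lemma neg_plus:
  assumes "1 \<le> i" "i < k" "k \<le> n+m" "1 \<le> l" "l \<le> k" "l \<noteq> i" "w \<in> C"
  shows "\<exists>c. E k i * (E l 0 * w) =\<^sub>K scal c * (E l 0 * (E k i * w))
     - scal (qdiff h * (-1) ^ \<theta> n l * of_bool (i < l \<and> l < k)) * (E l i * (E k 0 * w))"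
proof -
  let ?x = "exp (h * (- ((-1) ^ \<theta> n i * \<delta> i 0) + (-1) ^ \<theta> n i * \<delta> i l - (-1) ^ \<theta> n k * \<delta> k l))"
  let ?R = "- scal (qdiff h * (-1) ^ \<theta> n l * of_bool (i < l \<and> l < k)) * (E l i * E k 0)"
  have "sbr n ?x (Egen k i) (Egen l 0) - ?R \<in> neg_rels n m h"
    unfolding neg_rels_def mem_Collect_eq using assms
    by (intro exI[of _ k] exI[of _ i] exI[of _ l] exI[of _ 0])
       (auto simp: \<delta>_def root_less_def)
  then show ?thesis
    using assms sbr_rel[of ?x "Egen k i" "Egen l 0" ?R w]
    by (intro exI) (simp add: algebra_simps)
qed

text \<open>The relations between negative root vectors are oriented by the root order. For k < l
  the larger vector is e_{l0}, so this pair needs a rule of its own, and no correction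
  appears.\<close>

lemma plus_neg:
  assumes "1 \<le> i" "i < k" "k < l" "l \<le> n+m" "w \<in> C"
  shows "E l 0 * (E k i * w) =\<^sub>K scal ((-1) ^ (\<theta> n l * \<theta>2 n k i)) * (E k i * (E l 0 * w))"
proof -
  have "sbr n 1 (Egen l 0) (Egen k i) - 0 \<in> neg_rels n m h"
    unfolding neg_rels_def mem_Collect_eq using assms
    by (intro exI[of _ k] exI[of _ i] exI[of _ l] exI[of _ 0])
       (auto simp: \<delta>_def root_less_def)
  then show ?thesis
    using assms sbr_rel[of 1 "Egen l 0" "Egen k i" 0 w] by simp
qed


lemma cartan_commute:
  assumes "a \<in> cartan_gens n m" "b \<in> cartan_gens n m" "w \<in> C"
  shows "gvar a * (gvar b * w) =\<^sub>K gvar b * (gvar a * w)"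
proof -
  have "gvar a * gvar b - gvar b * gvar a \<in> cartan_rels n m h"
    using assms unfolding cartan_rels_def by blast
  then show ?thesis
    using K_rel[of "gvar a * gvar b - gvar b * gvar a" w] assms by (simp add: eqv_def algebra_simps)
qed

lemma L_Linv:
  assumes "1 \<le> i" "i \<le> n+m" "w \<in> C"
  shows "L i * (L' i * w) =\<^sub>K w"
proof -
  have "L i * L' i - 1 \<in> cartan_rels n m h"
    using assms unfolding cartan_rels_def by auto
  then show ?thesis
    using K_rel[of "L i * L' i - 1" w] assms by (simp add: eqv_def algebra_simps)
qed

lemma Linv_L:
  assumes "1 \<le> i" "i \<le> n+m" "w \<in> C"
  shows "L' i * (L i * w) =\<^sub>K w"
  using cartan_commute[of "Linv i" "Lgen i" w] L_Linv[OF assms] assms eqv_trans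
  by (auto simp: cartan_gens_def)

lemma H_E:
  assumes "1 \<le> i" "i \<le> n+m" "j \<le> n+m" "k \<le> n+m" "j \<noteq> k" "w \<in> C"
  shows "gvar (Hgen i) * (E j k * w) =\<^sub>K E j k * (gvar (Hgen i) * w) + scal (weight n i j k) * (E j k * w)"
proof -
  have "gvar (Hgen i) * E j k - E j k * gvar (Hgen i) - scal (weight n i j k) * E j k \<in> cartan_rels n m h"
    using assms unfolding cartan_rels_def by fastforce
  then show ?thesis
    using K_rel[of "gvar (Hgen i) * E j k - E j k * gvar (Hgen i) - scal (weight n i j k) * E j k" w] assms
    by (simp add: eqv_def algebra_simps)
qed

lemma L_E:
  assumes "1 \<le> i" "i \<le> n+m" "j \<le> n+m" "k \<le> n+m" "j \<noteq> k" "w \<in> C"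
  shows "L i * (E j k * w) =\<^sub>K scal (exp (h * weight n i j k)) * (E j k * (L i * w))"
proof -
  have "L i * E j k - scal (exp (h * weight n i j k)) * (E j k * L i) \<in> cartan_rels n m h"
    using assms unfolding cartan_rels_def by fastforce
  then show ?thesis
    using K_rel[of "L i * E j k - scal (exp (h * weight n i j k)) * (E j k * L i)" w] assms
    by (simp add: eqv_def algebra_simps)
qed

text \<open>The relations prescribe the commutation with e_{jk} for L alone; writing 1 = L' L in
  front and commuting L through yields the inverse scalar.\<close>

lemma Linv_E:
  assumes "1 \<le> i" "i \<le> n+m" "j \<le> n+m" "k \<le> n+m" "j \<noteq> k" "w \<in> C"
  shows "L' i * (E j k * w) =\<^sub>K scal (exp (- (h * weight n i j k))) * (E j k * (L' i * w))"
proof -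
  let ?c = "exp (h * weight n i j k)"
  have "E j k * (L' i * w) =\<^sub>K L' i * (L i * (E j k * (L' i * w)))"
    by (rule eqv_sym, rule Linv_L) (use assms in auto)
  also have "L' i * (L i * (E j k * (L' i * w))) =\<^sub>K L' i * (scal ?c * (E j k * (L i * (L' i * w))))"
    by (rule eqv_mult[OF _ L_E]) (use assms in auto)
  also have "\<dots> =\<^sub>K L' i * (scal ?c * (E j k * w))"
    by (intro eqv_mult eqv_scal L_Linv) (use assms in auto)
  also have "\<dots> = scal ?c * (L' i * (E j k * w))"
    by simp
  finally have "scal (inverse ?c) * (E j k * (L' i * w)) =\<^sub>K scal (inverse ?c) * (scal ?c * (L' i * (E j k * w)))"
    by (rule eqv_scal)
  then show ?thesis
    using eqv_sym by (simp add: exp_minus)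
qed

section \<open>Weight vectors\<close>

text \<open>\<open>Hgen i\<close>, \<open>Lgen i\<close> and \<open>Linv i\<close> are separate
  symbols linked only by relations, so each eigenvalue is recorded on its own.\<close>

definition has_weight :: "gen free_alg \<Rightarrow> (nat \<Rightarrow> complex) \<Rightarrow> bool" where
  "has_weight w \<mu> \<longleftrightarrow> w \<in> C \<and> (\<forall>i\<in>{1..n+m}.
     gvar (Hgen i) * w =\<^sub>K scal (\<mu> i) * w \<and>
     L i * w =\<^sub>K scal (exp (h * \<mu> i)) * w \<and>
     L' i * w =\<^sub>K scal (exp (- (h * \<mu> i))) * w)"

lemma has_weight_vacuum: "has_weight 1 (\<lambda>i. p)"
  using K_H K_L K_Linv by (simp add: has_weight_def eqv_def)

lemma has_weight_plus:
  assumes "has_weight w \<mu>" "1 \<le> j" "j \<le> n+m"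
  shows "has_weight (E j 0 * w) (\<lambda>i. \<mu> i + weight n i j 0)"
proof -
  have w: "w \<in> C" using assms by (simp add: has_weight_def)
  have "gvar (Hgen i) * (E j 0 * w) =\<^sub>K scal (\<mu> i + weight n i j 0) * (E j 0 * w)"
    and "L i * (E j 0 * w) =\<^sub>K scal (exp (h * (\<mu> i + weight n i j 0))) * (E j 0 * w)"
    and "L' i * (E j 0 * w) =\<^sub>K scal (exp (- (h * (\<mu> i + weight n i j 0)))) * (E j 0 * w)"
    if i: "1 \<le> i" "i \<le> n+m" for i
  proof -
    let ?c = "weight n i j 0"
    have wt: "gvar (Hgen i) * w =\<^sub>K scal (\<mu> i) * w" "L i * w =\<^sub>K scal (exp (h * \<mu> i)) * w"
       "L' i * w =\<^sub>K scal (exp (- (h * \<mu> i))) * w"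
      using assms i by (auto simp: has_weight_def)
    have "gvar (Hgen i) * (E j 0 * w) =\<^sub>K E j 0 * (gvar (Hgen i) * w) + scal ?c * (E j 0 * w)"
      by (rule H_E) (use assms w i in auto)
    also have "\<dots> =\<^sub>K E j 0 * (scal (\<mu> i) * w) + scal ?c * (E j 0 * w)"
      by (intro eqv_add eqv_mult wt) (use assms in auto)
    finally show "gvar (Hgen i) * (E j 0 * w) =\<^sub>K scal (\<mu> i + ?c) * (E j 0 * w)"
      by (simp add: scal_add distrib_right)
    have "L i * (E j 0 * w) =\<^sub>K scal (exp (h * ?c)) * (E j 0 * (L i * w))"
      by (rule L_E) (use assms w i in auto)
    also have "\<dots> =\<^sub>K scal (exp (h * ?c)) * (E j 0 * (scal (exp (h * \<mu> i)) * w))"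
      by (intro eqv_mult wt) (use assms in auto)
    finally show "L i * (E j 0 * w) =\<^sub>K scal (exp (h * (\<mu> i + ?c))) * (E j 0 * w)"
      by (simp add: distrib_left exp_add mult.commute)
    have "L' i * (E j 0 * w) =\<^sub>K scal (exp (- (h * ?c))) * (E j 0 * (L' i * w))"
      by (rule Linv_E) (use assms w i in auto)
    also have "\<dots> =\<^sub>K scal (exp (- (h * ?c))) * (E j 0 * (scal (exp (- (h * \<mu> i))) * w))"
      by (intro eqv_mult wt) (use assms in auto)
    finally show "L' i * (E j 0 * w) =\<^sub>K scal (exp (- (h * (\<mu> i + ?c)))) * (E j 0 * w)"
      by (simp add: distrib_left exp_add exp_diff exp_minus divide_inverse mult.commute)
  qed
  then show ?thesis using assms w by (simp add: has_weight_def)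
qed

lemma has_weight_plus_power:
  assumes "has_weight w \<mu>" "1 \<le> j" "j \<le> n+m"
  shows "has_weight (E j 0 ^ t * w) (\<lambda>i. \<mu> i + of_nat t * weight n i j 0)"
proof (induction t)
  case (Suc t)
  from has_weight_plus[OF this assms(2,3)] show ?case
    by (simp add: mult.assoc algebra_simps)
qed (use assms in simp)

section \<open>Words in the creation generators\<close>

text \<open>The argument \<open>y\<close> takes the place of the vacuum, so that a monomial can be
  cut at any factor and rewritten in the middle.\<close>

definition plus_word :: "nat list \<Rightarrow> (nat \<Rightarrow> nat) \<Rightarrow> gen free_alg \<Rightarrow> gen free_alg" where
  "plus_word xs r y = foldr (\<lambda>j x. E j 0 ^ r j * x) xs y"

lemma plus_word_simps [simp]: "plus_word [] r y = y" "plus_word (j # xs) r y = E j 0 ^ r j * plus_word xs r y"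
  "plus_word (xs @ ys) r y = plus_word xs r (plus_word ys r y)"
  by (simp_all add: plus_word_def)

lemma plus_word_C [simp]: "set xs \<subseteq> {1..n+m} \<Longrightarrow> y \<in> C \<Longrightarrow> plus_word xs r y \<in> C"
  by (induction xs) (auto intro!: free_algebra_closed_op free_algebra_closed_power)

lemma plus_word_cong: "(\<And>j. j \<in> set xs \<Longrightarrow> r j = r' j) \<Longrightarrow> plus_word xs r y = plus_word xs r' y"
  by (induction xs) auto

lemma plus_word_eqv: "set xs \<subseteq> {1..n+m} \<Longrightarrow> y =\<^sub>K z \<Longrightarrow> plus_word xs r y =\<^sub>K plus_word xs r z"
  by (induction xs) (auto intro!: eqv_mult)

lemma plus_word_scal: "plus_word xs r (scal c * y) = scal c * plus_word xs r y"
  by (induction xs) (auto simp:)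

lemma has_weight_word:
  assumes "has_weight w \<mu>" "set xs \<subseteq> {1..n+m}"
  shows "has_weight (plus_word xs r w) (\<lambda>i. \<mu> i + (\<Sum>j\<leftarrow>xs. of_nat (r j) * weight n i j 0))"
  using assms(2)
proof (induction xs)
  case (Cons j xs)
  then show ?case
    using has_weight_plus_power[of "plus_word xs r w" "\<lambda>i. \<mu> i + (\<Sum>j\<leftarrow>xs. of_nat (r j) * weight n i j 0)" j "r j"]
    by (simp add: algebra_simps)
qed (use assms in simp)

lemma plus_plus_power:
  assumes "1 \<le> k" "k < i" "i \<le> n+m" "w \<in> C"
  shows "E i 0 * (E k 0 ^ t * w) =\<^sub>K scal (((-1) ^ (\<theta> n i * \<theta> n k) * exp (- h)) ^ t) * (E k 0 ^ t * (E i 0 * w))"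
proof (induction t)
  case (Suc t)
  let ?c = "(-1) ^ (\<theta> n i * \<theta> n k) * exp (- h)"
  have C: "E k 0 ^ t * w \<in> C" using assms by (auto intro!: free_algebra_closed_op free_algebra_closed_power)
  have "E i 0 * (E k 0 * (E k 0 ^ t * w)) =\<^sub>K scal ?c * (E k 0 * (E i 0 * (E k 0 ^ t * w)))"
    by (rule plus_plus) (use assms C in auto)
  also have "\<dots> =\<^sub>K scal ?c * (E k 0 * (scal (?c ^ t) * (E k 0 ^ t * (E i 0 * w))))"
    by (intro eqv_mult Suc) (use assms in auto)
  finally show ?case by (simp add: mult.assoc)
qed simp

lemma plus_plus_word:
  assumes "set xs \<subseteq> {1..<i}" "i \<le> n+m" "w \<in> C"
  shows "E i 0 * plus_word xs r w =\<^sub>K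
    scal (\<Prod>k\<leftarrow>xs. ((-1) ^ (\<theta> n i * \<theta> n k) * exp (- h)) ^ r k) * plus_word xs r (E i 0 * w)"
  using assms(1)
proof (induction xs)
  case (Cons k xs)
  let ?c = "(-1) ^ (\<theta> n i * \<theta> n k) * exp (- h)"
  let ?d = "\<Prod>k\<leftarrow>xs. ((-1) ^ (\<theta> n i * \<theta> n k) * exp (- h)) ^ r k"
  have sub: "set xs \<subseteq> {1..n+m}" using Cons assms by auto
  have "E i 0 * (E k 0 ^ r k * plus_word xs r w) =\<^sub>K scal (?c ^ r k) * (E k 0 ^ r k * (E i 0 * plus_word xs r w))"
    by (rule plus_plus_power) (use Cons assms sub in auto)
  also have "\<dots> =\<^sub>K scal (?c ^ r k) * (E k 0 ^ r k * (scal ?d * plus_word xs r (E i 0 * w)))"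
    by (intro eqv_mult) (use Cons assms in auto)
  finally show ?case by simp
qed simp

section \<open>Null vectors\<close>

text \<open>For k different from i, e_{ki} is, up to a sign and an invertible Cartan factor, the
  bracket of a_i^- with a_k^+.\<close>

definition null_vectors :: "nat \<Rightarrow> gen free_alg set" where
  "null_vectors i = {w \<in> C. E 0 i * w \<in> K \<and> (\<forall>k\<in>{1..n+m}. k \<noteq> i \<longrightarrow> E k i * w \<in> K)}"

text \<open>The bracket of a_i^- with a_k^+ kills the vacuum, and its Cartan factor can be stripped
  off. For k < i that factor stands next to the vacuum and is replaced by its eigenvalue; for k > i
  it stands in front and is cancelled by left multiplication with its inverse.\<close>

lemma null_vectors_vacuum:
  assumes i: "i \<in> {1..n+m}"
  shows "1 \<in> null_vectors i"
proof -
  have "E k i \<in> K" if k: "k \<in> {1..n+m}" "k \<noteq> i" for k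
  proof (cases "k < i")
    case True
    have "E k i * L' k =\<^sub>K E k i * scal (exp (- (h * p)))"
      by (rule eqv_mult) (use K_Linv k i in \<open>auto simp: eqv_def\<close>)
    then have 1: "scal (exp (- (h * p))) * E k i =\<^sub>K E k i * L' k"
      using eqv_sym by (simp add: scal_commute)
    have "E 0 i * E k 0 =\<^sub>K scal ((-1) ^ (\<theta> n i * \<theta> n k)) * (E k 0 * E 0 i)
           - scal ((-1) ^ \<theta> n k) * (E k i * L' k)"
      using minus_plus_less[of k i 1] True k i by simp
    then have "sbr n 1 (Egen 0 i) (Egen k 0) =\<^sub>K - scal ((-1) ^ \<theta> n k) * (E k i * L' k)"
      by (simp add: eqv_def sbr_def algebra_simps)
    then have "- scal ((-1) ^ \<theta> n k) * (E k i * L' k) \<in> K"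
      using K_sbr[of i k] k i eqv_K eqv_sym by blast
    then have "scal (- ((-1) ^ \<theta> n k)) * (- scal ((-1) ^ \<theta> n k) * (E k i * L' k)) \<in> K"
      by (rule K_scal)
    then have "E k i * L' k \<in> K"
      by (simp add: scal_uminus flip: power_add)
    then have "scal (exp (h * p)) * (scal (exp (- (h * p))) * E k i) \<in> K"
      using 1 eqv_K K_scal by blast
    then show ?thesis by (simp add: scal_mult flip: mult.assoc exp_add)
  next
    case False
    have "E 0 i * E k 0 =\<^sub>K scal ((-1) ^ (\<theta> n i * \<theta> n k)) * (E k 0 * E 0 i)
           - scal ((-1) ^ \<theta> n i) * (L i * E k i)"
      using minus_plus_greater[of i k 1] False k i by simp
    then have "sbr n 1 (Egen 0 i) (Egen k 0) =\<^sub>K - scal ((-1) ^ \<theta> n i) * (L i * E k i)"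
      by (simp add: eqv_def sbr_def algebra_simps)
    then have "- scal ((-1) ^ \<theta> n i) * (L i * E k i) \<in> K"
      using K_sbr[of i k] k i eqv_K eqv_sym by blast
    then have "scal (- ((-1) ^ \<theta> n i)) * (- scal ((-1) ^ \<theta> n i) * (L i * E k i)) \<in> K"
      by (rule K_scal)
    then have "L i * E k i \<in> K"
      by (simp add: scal_uminus flip: power_add)
    then have "L' i * (L i * E k i) \<in> K"
      by (rule K_mult[rotated]) (use i in auto)
    then show ?thesis
      by (rule eqv_K[OF eqv_sym[OF Linv_L], rotated 3]) (use i k in auto)
  qed
  then show ?thesis using K_minus i by (simp add: null_vectors_def)
qed

text \<open>In each rule the main term ends in a column-i vector applied to \<open>w\<close>, and so
  does the correction after at most one more commutation. Cartan factors in between are moved out at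
  the cost of a nonzero scalar.\<close>

lemma null_vectors_plus:
  assumes w: "w \<in> null_vectors i" and i: "1 \<le> i" "i \<le> n+m" and l: "1 \<le> l" "l \<le> n+m" "l \<noteq> i"
  shows "E l 0 * w \<in> null_vectors i"
proof -
  have C: "w \<in> C" and B: "E 0 i * w \<in> K"
    and Ek: "\<And>k. 1 \<le> k \<Longrightarrow> k \<le> n+m \<Longrightarrow> k \<noteq> i \<Longrightarrow> E k i * w \<in> K"
    using w by (auto simp: null_vectors_def)
  have 1: "E l 0 * (E 0 i * w) \<in> K" and 2: "\<And>k. 1 \<le> k \<Longrightarrow> k \<le> n+m \<Longrightarrow> k \<noteq> i \<Longrightarrow> E l 0 * (E k i * w) \<in> K"
    using B Ek l by (auto intro!: K_mult[of "E l 0"])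
  have 3: "E l i * (L' l * w) \<in> K"
  proof -
    have "scal (exp (- (h * weight n l l i))) * (E l i * (L' l * w)) \<in> K"
      by (rule eqv_K[OF eqv_sym[OF Linv_E]]) (use Ek i l C in \<open>auto intro!: K_mult[of "L' l"]\<close>)
    from K_scal[OF this, of "exp (h * weight n l l i)"] show ?thesis by (simp flip: exp_add)
  qed
  have "E 0 i * (E l 0 * w) \<in> K"
  proof (cases "l < i")
    case True
    show ?thesis
      by (intro eqv_K[OF minus_plus_less] K_diff K_scal 1 3) (use True l i C in auto)
  next
    case False
    then show ?thesis
      by (intro eqv_K[OF minus_plus_greater] K_diff K_scal 1 K_mult[of "L i"] Ek) (use l i C in auto)
  qed
  moreover have "E k i * (E l 0 * w) \<in> K" if k: "1 \<le> k" "k \<le> n+m" "k \<noteq> i" for k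
  proof (cases "k < i")
    case True
    have "E l i * (E k 0 * (L k * (L' l * w))) \<in> K" if kl: "k < l" "l < i"
    proof -
      have 4: "E l i * (L k * (L' l * w)) \<in> K"
      proof -
        have "scal (exp (h * weight n k l i)) * (E l i * (L k * (L' l * w))) \<in> K"
          by (rule eqv_K[OF eqv_sym[OF L_E]]) (use 3 k i l C in \<open>auto intro!: K_mult[of "L k"]\<close>)
        from K_scal[OF this, of "exp (- (h * weight n k l i))"] show ?thesis by (simp flip: exp_add)
      qed
      \<comment> \<open>The same rule with k and l exchanged: since k < l < i, the index k lies
        outside the open interval from l to i and no further correction arises.\<close>
      have "E l i * (E k 0 * (L k * (L' l * w))) =\<^sub>K
              scal ((-1) ^ (\<theta>2 n l i * \<theta> n k)) * (E k 0 * (E l i * (L k * (L' l * w))))"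
        using pos_plus[of l i k "L k * (L' l * w)"] kl True k l i C by auto
      then show ?thesis
        by (rule eqv_K) (intro K_scal K_mult[of "E k 0"] 4, use k in auto)
    qed
    then have 3: "scal (qdiff h * of_bool (k < l \<and> l < i) * (-1) ^ \<theta> n l) * (E l i * (E k 0 * (L k * (L' l * w)))) \<in> K"
      by (cases "k < l \<and> l < i") (auto intro!: K_scal simp: K_zero)
    show ?thesis
      by (rule eqv_K[OF pos_plus K_add[OF K_scal[OF 2] 3]]) (use k True l i C in auto)
  next
    case False
    show ?thesis
    \<comment> \<open>Which of e_{ki} and e_{l0} is larger in the root order decides the rule; for l
      = k it is e_{ki}, because i > 0.\<close>
    proof (cases "l \<le> k")
      case True
      obtain c where c: "E k i * (E l 0 * w) =\<^sub>K scal c * (E l 0 * (E k i * w))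
         - scal (qdiff h * (-1) ^ \<theta> n l * of_bool (i < l \<and> l < k)) * (E l i * (E k 0 * w))"
        using neg_plus[of i k l w] True False l i k C by auto
      have "E l i * (E k 0 * w) \<in> K" if "i < l" "l < k"
      proof -
        have "scal ((-1) ^ (\<theta> n k * \<theta>2 n l i)) * (E l i * (E k 0 * w)) \<in> K"
          by (rule eqv_K[OF eqv_sym[OF plus_neg]]) (use that i k C Ek in \<open>auto intro!: K_mult[of "E k 0"]\<close>)
        from K_scal[OF this, of "(-1) ^ (\<theta> n k * \<theta>2 n l i)"] show ?thesis
          by (simp flip: power_add)
      qed
      then have 3: "scal (qdiff h * (-1) ^ \<theta> n l * of_bool (i < l \<and> l < k)) * (E l i * (E k 0 * w)) \<in> K"
        by (cases "i < l \<and> l < k") (auto intro!: K_scal simp: K_zero)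
      show ?thesis
        by (rule eqv_K[OF c K_diff[OF K_scal[OF 2] 3]]) (use k in auto)
    next
      case F: False
      have "scal ((-1) ^ (\<theta> n l * \<theta>2 n k i)) * (E k i * (E l 0 * w)) \<in> K"
        by (rule eqv_K[OF eqv_sym[OF plus_neg]]) (use False F i k l C Ek in \<open>auto intro!: K_mult[of "E l 0"]\<close>)
      from K_scal[OF this, of "(-1) ^ (\<theta> n l * \<theta>2 n k i)"] show ?thesis
        by (simp flip: power_add)
    qed
  qed
  ultimately show ?thesis using C l by (simp add: null_vectors_def)
qed

text \<open>The index i may occur in the word with exponent 0, which admits the full list of indices
  for \<open>r(i := 0)\<close>.\<close>

lemma null_vectors_word:
  assumes "y \<in> null_vectors i" "1 \<le> i" "i \<le> n+m" "set xs \<subseteq> {1..n+m}" "\<And>j. j \<in> set xs \<Longrightarrow> j = i \<Longrightarrow> r j = 0"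
  shows "plus_word xs r y \<in> null_vectors i"
  using assms(4,5)
proof (induction xs)
  case (Cons j xs)
  have "E j 0 ^ t * plus_word xs r y \<in> null_vectors i" if "j \<noteq> i" for t
    using that Cons assms by (induction t) (auto intro!: null_vectors_plus simp: mult.assoc)
  then show ?case using Cons by (cases "j = i") auto
qed (use assms in auto)


section \<open>The rank one computation\<close>

text \<open>The bracket of a_i^- with a_i^+ is (L_i - L_i^-1)/(q - q^-1), which acts on a weight
  vector as a quantum number.\<close>

lemma minus_plus_weight:
  assumes "has_weight x \<nu>" "1 \<le> i" "i \<le> n+m"
  shows "E 0 i * (E i 0 * x) =\<^sub>K scal ((-1) ^ \<theta> n i) * (E i 0 * (E 0 i * x)) + scal (qnum h (\<nu> i)) * x"
proof -
  have x: "x \<in> C" "L i * x =\<^sub>K scal (exp (h * \<nu> i)) * x" "L' i * x =\<^sub>K scal (exp (- (h * \<nu> i))) * x"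
    using assms by (auto simp: has_weight_def)
  have "E 0 i * (E i 0 * x) =\<^sub>K scal ((-1) ^ \<theta> n i) * (E i 0 * (E 0 i * x))
           + scal (1 / qdiff h) * (L i * x - L' i * x)"
    by (rule minus_plus_same) (use assms x in auto)
  also have "\<dots> =\<^sub>K scal ((-1) ^ \<theta> n i) * (E i 0 * (E 0 i * x))
           + scal (1 / qdiff h) * (scal (exp (h * \<nu> i)) * x - scal (exp (- (h * \<nu> i))) * x)"
    by (intro eqv_add eqv_refl eqv_scal eqv_diff x)
  also have "scal (1 / qdiff h) * (scal (exp (h * \<nu> i)) * x - scal (exp (- (h * \<nu> i))) * x)
      = scal (qnum h (\<nu> i)) * x"
    by (simp add: qnum_def diff_divide_distrib scal_diff left_diff_distrib right_diff_distrib)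
  finally show ?thesis .
qed

text \<open>For even i the proof is an induction on \<open>s\<close>, each a_i^+ lowering the weight
  at i by 2 as in U_q[sl(2)]. For odd i only s = 0 and s = 1 remain, and the bracket is used
  once.\<close>

lemma minus_plus_power:
  assumes h: "qdiff h \<noteq> 0" and w: "w \<in> null_vectors i" "has_weight w \<mu>"
    and i: "1 \<le> i" "i \<le> n+m" and s: "\<theta> n i \<noteq> 0 \<Longrightarrow> s \<le> 1"
  shows "E 0 i * (E i 0 ^ s * w) =\<^sub>K
    scal (qnum h (of_nat s) * qnum h (\<mu> i - of_nat s + 1)) * (E i 0 ^ (s - 1) * w)"
proof (cases "\<theta> n i = 0")
  case True
  show ?thesis
  proof (induction s)
    case 0
    then show ?case using w by (simp add: null_vectors_def K_iff_eqv)
  next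
    case (Suc s)
    let ?x = "E i 0 ^ s * w"
    have x: "has_weight ?x (\<lambda>j. \<mu> j + of_nat s * weight n j i 0)"
      using has_weight_plus_power w i by blast
    have "E 0 i * (E i 0 * ?x) =\<^sub>K E i 0 * (E 0 i * ?x) + scal (qnum h (\<mu> i - of_nat s * 2)) * ?x"
      using minus_plus_weight[OF x i] True i by (simp add: weight_plus)
    also have "\<dots> =\<^sub>K E i 0 * (scal (qnum h (of_nat s) * qnum h (\<mu> i - of_nat s + 1)) * (E i 0 ^ (s - 1) * w))
        + scal (qnum h (\<mu> i - of_nat s * 2)) * ?x"
      by (intro eqv_add eqv_mult Suc) (use i in auto)
    \<comment> \<open>For s = 0 the truncated \<open>s - 1\<close> is harmless, since [0] =
      0.\<close>
    also have "E i 0 * (scal (qnum h (of_nat s) * qnum h (\<mu> i - of_nat s + 1)) * (E i 0 ^ (s - 1) * w))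
        = scal (qnum h (of_nat s) * qnum h (\<mu> i - of_nat s + 1)) * ?x"
      by (cases s) (simp_all add: mult.assoc)
    also have "\<dots> + scal (qnum h (\<mu> i - of_nat s * 2)) * ?x =
       scal (qnum h (of_nat s) * qnum h (\<mu> i - of_nat s + 1) + qnum h (\<mu> i - of_nat s * 2)) * ?x"
      by (simp add: scal_add distrib_right)
    also have "qnum h (of_nat s) * qnum h (\<mu> i - of_nat s + 1) + qnum h (\<mu> i - of_nat s * 2)
       = qnum h (of_nat (Suc s)) * qnum h (\<mu> i - of_nat (Suc s) + 1)"
    proof -
      \<comment> \<open>Clearing the nonzero denominators leaves an identity between sums of
        exponentials, which \<open>exp_add\<close> settles.\<close>
      have *: "qnum h a * qnum h b + qnum h c = qnum h d * qnum h e"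
        if "(exp (h * a) - exp (- (h * a))) * (exp (h * b) - exp (- (h * b)))
          + (exp (h * c) - exp (- (h * c))) * qdiff h
          = (exp (h * d) - exp (- (h * d))) * (exp (h * e) - exp (- (h * e)))" for a b c d e
        using that h by (simp add: qnum_def divide_simps)
      show ?thesis
        by (rule *) (simp add: qdiff_def algebra_simps flip: exp_add)
    qed
    finally show ?case by (simp add: mult.assoc)
  qed
next
  case False
  then have "s = 0 \<or> s = 1" using s by auto
  moreover have Bw: "E 0 i * w =\<^sub>K 0" using w by (simp add: null_vectors_def K_iff_eqv)
  moreover have "E 0 i * (E i 0 * w) =\<^sub>K scal (qnum h (\<mu> i)) * w"
  proof -
    have "E 0 i * (E i 0 * w) =\<^sub>K scal ((-1) ^ \<theta> n i) * (E i 0 * (E 0 i * w)) + scal (qnum h (\<mu> i)) * w"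
      by (rule minus_plus_weight[OF w(2) i])
    also have "\<dots> =\<^sub>K scal ((-1) ^ \<theta> n i) * (E i 0 * 0) + scal (qnum h (\<mu> i)) * w"
      by (intro eqv_add eqv_scal eqv_mult[of "E i 0"] eqv_refl) (use i Bw in auto)
    finally show ?thesis by simp
  qed
  moreover have "qnum h 1 = 1" using h by (simp add: qnum_def qdiff_def)
  ultimately show ?thesis by auto
qed

section \<open>Action of the Jacobson generators on monomials\<close>

definition plus_monomial :: "(nat \<Rightarrow> nat) \<Rightarrow> gen free_alg" where
  "plus_monomial r = plus_word [1..<n+m+1] r 1"

lemma plus_monomial_split:
  assumes "1 \<le> i" "i \<le> n+m"
  shows "plus_monomial r = plus_word [1..<i] r (E i 0 ^ r i * plus_word [i+1..<n+m+1] r 1)"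
proof -
  have "[1..<n+m+1] = [1..<i] @ i # [i+1..<n+m+1]"
    using assms by (metis Suc_eq_plus1 le_imp_less_Suc less_imp_le_nat upt_add_eq_append upt_conv_Cons le_Suc_ex)
  then show ?thesis by (simp add: plus_monomial_def)
qed

text \<open>Each a_j^+ contributes -1 to the weight at i, and for j = i a further
  -(-1)^{\<theta>_i}. Only the component at i is needed in closed form.\<close>

lemma has_weight_plus_monomial:
  assumes "1 \<le> i" "i \<le> n+m"
  shows "\<exists>\<mu>. has_weight (plus_monomial r) \<mu> \<and> \<mu> i = p - (-1) ^ \<theta> n i * of_nat (r i) - (\<Sum>j=1..n+m. of_nat (r j))"
proof -
  have "(\<Sum>j=1..n+m. of_nat (r j) * weight n i j 0) = (\<Sum>j=1..n+m. - of_nat (r j) - (if i = j then (-1) ^ \<theta> n i * of_nat (r i) else 0))"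
    by (rule sum.cong) (use assms in \<open>auto simp: weight_plus algebra_simps\<close>)
  also have "\<dots> = - (\<Sum>j=1..n+m. of_nat (r j)) - (-1) ^ \<theta> n i * of_nat (r i)"
    using assms by (simp add: sum_subtractf sum_negf)
  finally have "p + (\<Sum>j\<leftarrow>[1..<n+m+1]. of_nat (r j) * weight n i j 0)
     = p - (-1) ^ \<theta> n i * of_nat (r i) - (\<Sum>j=1..n+m. of_nat (r j))"
    by (simp only: sum_list_upt) (simp add: atLeastLessThanSuc_atLeastAtMost)
  moreover have "has_weight (plus_monomial r) (\<lambda>i. p + (\<Sum>j\<leftarrow>[1..<n+m+1]. of_nat (r j) * weight n i j 0))"
    unfolding plus_monomial_def by (rule has_weight_word[OF has_weight_vacuum]) auto
  ultimately show ?thesis by blast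
qed

lemma H_plus_monomial:
  assumes "1 \<le> i" "i \<le> n+m"
  shows "gvar (Hgen i) * plus_monomial r =\<^sub>K
    scal (p - (-1) ^ \<theta> n i * of_nat (r i) - (\<Sum>j=1..n+m. of_nat (r j))) * plus_monomial r"
proof -
  obtain \<mu> where \<mu>: "has_weight (plus_monomial r) \<mu>"
      "\<mu> i = p - (-1) ^ \<theta> n i * of_nat (r i) - (\<Sum>j=1..n+m. of_nat (r j))"
    using has_weight_plus_monomial[OF assms] by blast
  have "gvar (Hgen i) * plus_monomial r =\<^sub>K scal (\<mu> i) * plus_monomial r"
    using \<mu>(1) assms by (auto simp: has_weight_def)
  then show ?thesis by (simp only: \<mu>(2))
qed

text \<open>The factor picked up by one a_i^+ on its way past all a_j^+ with j < i. It does not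
  involve \<open>r i\<close>, so every further a_i^+ picks up the same factor.\<close>

definition swap_coeff :: "nat \<Rightarrow> (nat \<Rightarrow> nat) \<Rightarrow> complex" where
  "swap_coeff i r = (-1) ^ (\<Sum>j=1..<i. \<theta> n j * r j) * exp (- (h * (\<Sum>j=1..<i. of_nat (r j))))"

text \<open>An identity of words with arbitrary exponents: for odd i the right side may contain
  (a_i^+)^2, whose vanishing is taken up in \<open>plus_plus_monomial\<close>.\<close>

lemma plus_plus_monomial_upd:
  assumes "1 \<le> i" "i \<le> n+m"
  shows "E i 0 * plus_monomial r =\<^sub>K scal (swap_coeff i r) * plus_monomial (r(i := r i + 1))"
proof -
  \<comment> \<open>\<theta> is monotone, so \<open>\<theta> n i * \<theta> n k\<close> equals
    \<open>\<theta> n k\<close> for k < i; this removes \<theta>_i from the sign.\<close>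
  have "(\<Prod>k\<leftarrow>[1..<i]. ((-1) ^ (\<theta> n i * \<theta> n k) * exp (- h)) ^ r k)
     = (\<Prod>k=1..<i. (-1) ^ (\<theta> n k * r k) * exp (- (h * of_nat (r k))))"
    unfolding prod_list_upt
    by (rule prod.cong)
       (auto simp: \<theta>_def power_mult_distrib mult.commute exp_minus exp_of_nat2_mult power_inverse simp flip: power_mult)
  also have "\<dots> = swap_coeff i r"
    by (simp add: swap_coeff_def prod.distrib power_sum sum_distrib_left exp_sum flip: sum_negf)
  finally have c: "(\<Prod>k\<leftarrow>[1..<i]. ((-1) ^ (\<theta> n i * \<theta> n k) * exp (- h)) ^ r k) = swap_coeff i r" .
  let ?S = "plus_word [i+1..<n+m+1]"
  have "E i 0 * plus_word [1..<i] r (E i 0 ^ r i * ?S r 1) =\<^sub>K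
     scal (swap_coeff i r) * plus_word [1..<i] r (E i 0 * (E i 0 ^ r i * ?S r 1))"
    unfolding c[symmetric]
    by (intro plus_plus_word free_algebra_closed_op(4) free_algebra_closed_power plus_word_C) (use assms in auto)
  also have "plus_word [1..<i] r (E i 0 * (E i 0 ^ r i * ?S r 1)) = plus_monomial (r(i := r i + 1))"
  proof -
    have "?S r 1 = ?S (r(i := r i + 1)) 1"
      by (rule plus_word_cong) auto
    moreover have "plus_word [1..<i] r = plus_word [1..<i] (r(i := r i + 1))"
      by (intro ext plus_word_cong) auto
    ultimately show ?thesis
      by (simp add: plus_monomial_split[OF assms] mult.assoc del: upt_Suc)
  qed
  finally show ?thesis by (simp only: plus_monomial_split[OF assms, of r])
qed

lemma swap_coeff_upd [simp]: "swap_coeff i (r(i := t)) = swap_coeff i r"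
  by (simp add: swap_coeff_def)

text \<open>Builds up exponent i from 0, one factor \<open>swap_coeff i r\<close> per step. Read
  backwards, it brings all a_i^+ to the front of a word free of a_i^+.\<close>

lemma plus_power_plus_monomial:
  assumes "1 \<le> i" "i \<le> n+m"
  shows "E i 0 ^ t * plus_monomial (r(i := 0)) =\<^sub>K scal (swap_coeff i r ^ t) * plus_monomial (r(i := t))"
proof (induction t)
  case (Suc t)
  have "E i 0 * (E i 0 ^ t * plus_monomial (r(i := 0))) =\<^sub>K E i 0 * (scal (swap_coeff i r ^ t) * plus_monomial (r(i := t)))"
    by (rule eqv_mult[OF _ Suc]) (use assms in auto)
  also have "\<dots> = scal (swap_coeff i r ^ t) * (E i 0 * plus_monomial (r(i := t)))"
    by simp
  also have "\<dots> =\<^sub>K scal (swap_coeff i r ^ t) * (scal (swap_coeff i r) * plus_monomial (r(i := Suc t)))"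
    using plus_plus_monomial_upd[OF assms, of "r(i := t)"] by (intro eqv_scal) simp
  finally show ?case
    by (simp only: scal_mult_left power_Suc[of "E i 0"] power_Suc2[of "swap_coeff i r"] mult.assoc)
qed simp

text \<open>Once all a_i^+ stand in front, the remaining \<open>plus_monomial (r(i := 0))\<close> is
  an i-null weight vector and \<open>minus_plus_power\<close> applies.\<close>

lemma minus_plus_monomial:
  assumes h: "qdiff h \<noteq> 0" and i: "1 \<le> i" "i \<le> n+m" and r: "\<theta> n i \<noteq> 0 \<Longrightarrow> r i \<le> 1"
  shows "E 0 i * plus_monomial r =\<^sub>K
    scal ((-1) ^ (\<Sum>j=1..<i. \<theta> n j * r j) * exp (h * (\<Sum>j=1..<i. of_nat (r j)))
       * qnum h (of_nat (r i)) * qnum h (p - (\<Sum>j=1..n+m. of_nat (r j)) + 1)) * plus_monomial (r(i := r i - 1))"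
proof -
  let ?c = "swap_coeff i r" and ?w = "plus_monomial (r(i := 0))"
  let ?d = "qnum h (of_nat (r i)) * qnum h (p - (\<Sum>j=1..n+m. of_nat (r j)) + 1)"
  have c: "?c \<noteq> 0" by (simp add: swap_coeff_def)
  obtain \<mu> where \<mu>: "has_weight ?w \<mu>" "\<mu> i = p - (\<Sum>j=1..n+m. of_nat ((r(i := 0)) j))"
    using has_weight_plus_monomial[OF i, of "r(i := 0)"] by auto
  have "(\<Sum>j=1..n+m. of_nat ((r(i := 0)) j)) = (\<Sum>j=1..n+m. of_nat (r j) - (if i = j then of_nat (r i) else 0 :: complex))"
    by (rule sum.cong) auto
  also have "\<dots> = (\<Sum>j=1..n+m. of_nat (r j)) - of_nat (r i)"
    using i by (simp add: sum_subtractf)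
  \<comment> \<open>The weight of the remaining word at i is p minus the sum over j different from
    i; subtracting r_i completes it to the full sum.\<close>
  finally have \<mu>i: "\<mu> i - of_nat (r i) + 1 = p - (\<Sum>j=1..n+m. of_nat (r j)) + 1"
    using \<mu>(2) by simp
  have null: "?w \<in> null_vectors i"
    unfolding plus_monomial_def by (rule null_vectors_word[OF null_vectors_vacuum]) (use i in auto)
  have "plus_monomial r =\<^sub>K scal (inverse ?c ^ r i) * (E i 0 ^ r i * ?w)"
    using eqv_scal[OF eqv_sym[OF plus_power_plus_monomial[OF i, of "r i" r]], of "inverse ?c ^ r i"] c
    by (simp flip: power_mult_distrib)
  then have "E 0 i * plus_monomial r =\<^sub>K E 0 i * (scal (inverse ?c ^ r i) * (E i 0 ^ r i * ?w))"
    by (intro eqv_mult) (use i in auto)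
  also have "\<dots> = scal (inverse ?c ^ r i) * (E 0 i * (E i 0 ^ r i * ?w))"
    by simp
  also have "\<dots> =\<^sub>K scal (inverse ?c ^ r i) * (scal ?d * (E i 0 ^ (r i - 1) * ?w))"
    using minus_plus_power[OF h null \<mu>(1) i r] by (intro eqv_scal) (simp add: \<mu>i)
  also have "\<dots> =\<^sub>K scal (inverse ?c ^ r i) * (scal ?d * (scal (?c ^ (r i - 1)) * plus_monomial (r(i := r i - 1))))"
    by (intro eqv_scal plus_power_plus_monomial i)
  \<comment> \<open>r_i exchange factors are inverted and r_i - 1 are restored. For r_i = 0 both
    sides vanish because [0] = 0.\<close>
  also have "\<dots> = scal (inverse ?c * ?d) * plus_monomial (r(i := r i - 1))"
    using c by (cases "r i") (simp_all add: field_simps)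
  \<comment> \<open>The sign is its own inverse, so only the exponent of q changes.\<close>
  also have "inverse ?c = (-1) ^ (\<Sum>j=1..<i. \<theta> n j * r j) * exp (h * (\<Sum>j=1..<i. of_nat (r j)))"
    by (simp add: swap_coeff_def exp_minus power_inverse[symmetric])
  finally show ?thesis by (simp only: mult.assoc)
qed

lemma plus_square:
  assumes "1 \<le> i" "i \<le> n+m" "\<theta> n i = 1" "w \<in> C"
  shows "E i 0 * (E i 0 * w) \<in> K"
proof -
  have "E i 0 * E i 0 \<in> cartan_rels n m h"
    unfolding cartan_rels_def using assms by (intro UnI2 CollectI exI[of _ i] exI[of _ 0]) auto
  then show ?thesis using K_rel[of "E i 0 * E i 0" w] assms by (simp add: mult.assoc)
qed

text \<open>For odd i with r_i = 1 both sides vanish, the left one by (a_i^+)^2 = 0 and the right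
  one by its last factor; in all other cases that factor is 1.\<close>

lemma plus_plus_monomial:
  assumes i: "1 \<le> i" "i \<le> n+m" and r: "\<theta> n i \<noteq> 0 \<Longrightarrow> r i \<le> 1"
  shows "E i 0 * plus_monomial r =\<^sub>K
    scal ((-1) ^ (\<Sum>j=1..<i. \<theta> n j * r j) * exp (- (h * (\<Sum>j=1..<i. of_nat (r j))))
       * (1 - of_nat (\<theta> n i * r i))) * plus_monomial (r(i := r i + 1))"
proof (cases "\<theta> n i * r i = 0")
  case True
  then show ?thesis using plus_plus_monomial_upd[OF i, of r] by (auto simp: swap_coeff_def)
next
  case False
  then have t: "\<theta> n i = 1" "r i = 1" using r by (auto simp: \<theta>_def split: if_splits)
  let ?S = "plus_word [i+1..<n+m+1] r 1"
  have S: "?S \<in> C" by (rule plus_word_C) (use i in auto)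
  have "E i 0 * plus_word [1..<i] r (E i 0 * ?S) =\<^sub>K
     scal (\<Prod>k\<leftarrow>[1..<i]. ((-1) ^ (\<theta> n i * \<theta> n k) * exp (- h)) ^ r k) * plus_word [1..<i] r (E i 0 * (E i 0 * ?S))"
    by (intro plus_plus_word free_algebra_closed_op(4) plus_word_C) (use i in auto)
  \<comment> \<open>Zero is written as \<open>scal 0 * 1\<close> so that
    \<open>plus_word_scal\<close> can carry it through the word.\<close>
  also have "\<dots> =\<^sub>K scal (\<Prod>k\<leftarrow>[1..<i]. ((-1) ^ (\<theta> n i * \<theta> n k) * exp (- h)) ^ r k) * plus_word [1..<i] r (scal 0 * 1)"
    using plus_square[OF i t(1) S] i
    by (intro eqv_scal plus_word_eqv) (auto simp: K_iff_eqv simp del: upt_Suc)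
  finally show ?thesis using t unfolding plus_word_scal by (simp add: plus_monomial_split[OF i, of r] del: upt_Suc)
qed

end

section \<open>The quotient algebra\<close>

lemma Uq_relations_closed:
  "cartan_rels n m h \<union> pos_rels n m h \<union> neg_rels n m h \<union> mixed_rels n m h
     \<subseteq> carrier (free_algebra (gens n m))"
proof -
  let ?C = "carrier (free_algebra (gens n m))"
  have gens [simp]: "Hgen i \<in> gens n m \<longleftrightarrow> i \<in> {1..n+m}" "Lgen i \<in> gens n m \<longleftrightarrow> i \<in> {1..n+m}"
      "Linv i \<in> gens n m \<longleftrightarrow> i \<in> {1..n+m}" "Egen i j \<in> gens n m \<longleftrightarrow> i \<le> n+m \<and> j \<le> n+m \<and> i \<noteq> j"
      for i j
    by (auto simp: gens_def cartan_gens_def)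
  have cartan: "a \<in> gens n m" if "a \<in> cartan_gens n m" for a
    using that by (simp add: gens_def)
  have L: "Lel i \<in> ?C" "Lbar i \<in> ?C" if "i \<le> n+m" for i
    using that by (auto simp: Lel_def Lbar_def)
  have Ls: "Lsgn n j i \<in> ?C" "Lbarsgn n j i \<in> ?C" if "i \<le> n+m" for i j
    using that by (auto simp: Lsgn_def Lbarsgn_def L)
  note sum_closed = free_algebra_closed_op(1-3)
  have gg: "gvar a * gvar b \<in> ?C" if "a \<in> gens n m" "b \<in> gens n m" for a b
    using that by auto
  have LL: "Lsgn n i j * Lbarsgn n i i \<in> ?C" "Lbarsgn n i j * Lsgn n i i \<in> ?C"
      "f \<in> ?C \<Longrightarrow> f * (Lel i * Lbar j) \<in> ?C" "f \<in> ?C \<Longrightarrow> Lel i * Lbar j * f \<in> ?C"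
    if "i \<le> n+m" "j \<le> n+m" for i j f
    using that L Ls by auto
  note closed = sum_closed gg LL free_algebra_closed(2,4) scal_mult_closed
  have "cartan_rels n m h \<subseteq> ?C"
    unfolding cartan_rels_def by (auto intro!: sum_closed gg free_algebra_closed(2,4) scal_mult_closed intro: cartan)
  moreover have "pos_rels n m h \<subseteq> ?C"
    unfolding pos_rels_def sbr_def
    by (rule subsetI, elim CollectE exE conjE, hypsubst, intro closed) (simp_all add: \<delta>_def)
  moreover have "neg_rels n m h \<subseteq> ?C"
    unfolding neg_rels_def sbr_def
    by (rule subsetI, elim CollectE exE conjE, hypsubst, intro closed) (simp_all add: \<delta>_def)
  moreover have "mixed_rels n m h \<subseteq> ?C"
    unfolding mixed_rels_def sbr_def
    by (rule subsetI, elim CollectE exE conjE, hypsubst, intro closed) (simp_all add: \<delta>_def)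
  ultimately show ?thesis by blast
qed

lemma ideal_Uq_ideal: "ideal (Uq_ideal n m h) (free_algebra (gens n m))"
  unfolding Uq_ideal_def by (rule ring.genideal_ideal[OF ring_free_algebra Uq_relations_closed])

lemma ring_hom_Uq_class:
  "ring_hom_ring (free_algebra (gens n m)) (Uq n m h) (Uq_class n m h)"
proof -
  have "Uq_class n m h = (+>\<^bsub>free_algebra (gens n m)\<^esub>) (Uq_ideal n m h)"
    by (simp add: Uq_class_def fun_eq_iff)
  then show ?thesis
    unfolding Uq_def by (simp add: ideal.rcos_ring_hom_ring[OF ideal_Uq_ideal])
qed

lemma ring_Uq: "ring (Uq n m h)"
  unfolding Uq_def by (rule ideal.quotient_is_ring[OF ideal_Uq_ideal])

context
  fixes n m :: nat and h :: complex
begin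

abbreviation (input) "FA \<equiv> carrier (free_algebra (gens n m))"

lemma Uq_class_closed [simp]: "f \<in> FA \<Longrightarrow> Uq_class n m h f \<in> carrier (Uq n m h)"
  using ring_hom_ring.homh[OF ring_hom_Uq_class] by (rule ring_hom_closed)

lemma Uq_class_mult:
  "f \<in> FA \<Longrightarrow> g \<in> FA \<Longrightarrow> Uq_class n m h (f * g) = Uq_class n m h f \<otimes>\<^bsub>Uq n m h\<^esub> Uq_class n m h g"
  using ring_hom_mult[OF ring_hom_ring.homh[OF ring_hom_Uq_class]] by fastforce

lemma Uq_class_add:
  "f \<in> FA \<Longrightarrow> g \<in> FA \<Longrightarrow> Uq_class n m h (f + g) = Uq_class n m h f \<oplus>\<^bsub>Uq n m h\<^esub> Uq_class n m h g"
  using ring_hom_add[OF ring_hom_ring.homh[OF ring_hom_Uq_class]] by fastforce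

lemma Uq_class_one: "Uq_class n m h 1 = \<one>\<^bsub>Uq n m h\<^esub>"
  using ring_hom_one[OF ring_hom_ring.homh[OF ring_hom_Uq_class]] by fastforce

lemma Uq_class_power:
  "f \<in> FA \<Longrightarrow> Uq_class n m h (f ^ k) = Uq_class n m h f [^]\<^bsub>Uq n m h\<^esub> k"
proof (induction k)
  case (Suc k)
  then show ?case
    by (simp only: power_Suc2 Uq_class_mult free_algebra_closed_power nat_pow_Suc)
qed (simp add: Uq_class_one)

lemma Uq_class_rel:
  assumes "u \<in> cartan_rels n m h \<union> pos_rels n m h \<union> neg_rels n m h \<union> mixed_rels n m h"
  shows "Uq_class n m h u = Uq_class n m h 0"
proof -
  interpret ideal "Uq_ideal n m h" "free_algebra (gens n m)" by (rule ideal_Uq_ideal)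
  have u: "u \<in> Uq_ideal n m h"
    using genideal_self[OF Uq_relations_closed] assms unfolding Uq_ideal_def by blast
  have z: "(0::gen free_alg) \<in> Uq_ideal n m h"
    using additive_subgroup.zero_closed[OF is_additive_subgroup] by simp
  show ?thesis
    unfolding Uq_class_def using a_rcos_const[OF u] a_rcos_const[OF z] by simp
qed

lemma P_alg_subset: "P_alg n m h \<subseteq> carrier (Uq n m h)"
  unfolding P_alg_def
proof (rule ring.generate_ring_incl[OF ring_Uq], rule image_subsetI)
  fix f assume f: "f \<in> range scal \<union> gvar ` cartan_gens n m
      \<union> {sbr n 1 (Egen i 0) (Egen 0 j) | i j. i \<in> {1..n+m} \<and> j \<in> {1..n+m} \<and> i \<noteq> j}
      \<union> {gvar (Egen 0 i) | i. i \<in> {1..n+m}}"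
  have E: "gvar (Egen i j) \<in> FA" if "i \<le> n+m" "j \<le> n+m" "i \<noteq> j" for i j
    using that by (intro free_algebra_closed) (auto simp: gens_def)
  have "gvar a \<in> FA" if "a \<in> cartan_gens n m" for a
    using that by (intro free_algebra_closed) (simp add: gens_def)
  with f have "f \<in> FA" by (auto intro!: E free_algebra_closed_op simp: sbr_def)
  then show "Uq_class n m h f \<in> carrier (Uq n m h)" by simp
qed

end

section \<open>The induced module\<close>

context
  fixes R :: "('a, 'b) ring_scheme" and P :: "'a set" and act :: "'a \<Rightarrow> 'v \<Rightarrow> 'v::ab_group_add"
  assumes R: "ring R" and P: "P \<subseteq> carrier R"
begin

interpretation ring R by (rule R)

abbreviation (input) "T \<equiv> tensor_rels R P act"
abbreviation (input) "lmult y \<equiv> frag_extend (\<lambda>(x, v). frag_of (y \<otimes>\<^bsub>R\<^esub> x, v))"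

lemma subgroup_tensor_rels: "subgroup T (pair_group R)"
proof -
  have closed: "x \<otimes>\<^bsub>R\<^esub> s \<in> carrier R" if "x \<in> carrier R" "s \<in> P" for x s
    using that P m_closed[of x s] by blast
  have "group (pair_group R)" by (simp add: pair_group_def)
  then show ?thesis unfolding tensor_rels_def
    by (rule group.generate_is_subgroup) (use P in \<open>auto simp: pair_group_def closed dest!: subsetD[OF keys_diff]\<close>)
qed

lemma tensor_rels_zero: "0 \<in> T"
  using subgroup.one_closed[OF subgroup_tensor_rels] by (simp add: pair_group_def)

lemma tensor_rels_add: "f \<in> T \<Longrightarrow> g \<in> T \<Longrightarrow> f + g \<in> T"
  using subgroup.m_closed[OF subgroup_tensor_rels] by (simp add: pair_group_def)

lemma tensor_rels_uminus:
  assumes f: "f \<in> T" shows "- f \<in> T"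
proof -
  have "Poly_Mapping.keys f \<subseteq> carrier R \<times> UNIV"
    using subgroup.mem_carrier[OF subgroup_tensor_rels f] by (simp add: pair_group_def)
  then show ?thesis
    using subgroup.m_inv_closed[OF subgroup_tensor_rels f] by (simp add: pair_group_def)
qed

lemma tensor_rels_diff: "f \<in> T \<Longrightarrow> g \<in> T \<Longrightarrow> f - g \<in> T"
  using tensor_rels_add[of f "- g"] tensor_rels_uminus by simp

lemma tensor_rels_left_distrib:
  "x \<in> carrier R \<Longrightarrow> y \<in> carrier R \<Longrightarrow>
     frag_of (x \<oplus>\<^bsub>R\<^esub> y, v) - frag_of (x, v) - frag_of (y, v) \<in> T"
  unfolding tensor_rels_def by (rule generate.incl) blast

lemma tensor_rels_right_distrib:
  "x \<in> carrier R \<Longrightarrow> frag_of (x, v + w) - frag_of (x, v) - frag_of (x, w) \<in> T"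
  unfolding tensor_rels_def by (rule generate.incl) blast

lemma tensor_rels_balanced:
  "x \<in> carrier R \<Longrightarrow> s \<in> P \<Longrightarrow> frag_of (x \<otimes>\<^bsub>R\<^esub> s, v) - frag_of (x, act s v) \<in> T"
  unfolding tensor_rels_def by (rule generate.incl) blast

text \<open>Left multiplication by \<open>y\<close> sends each generating relation to one of the
  same kind with x replaced by yx, by distributivity and associativity; additivity extends this to
  the generated subgroup.\<close>

lemma tensor_rels_lmult:
  assumes f: "f \<in> T" and y: "y \<in> carrier R"
  shows "lmult y f \<in> T"
proof -
  let ?A = "{frag_of (x \<oplus>\<^bsub>R\<^esub> y, v) - frag_of (x, v) - frag_of (y, v)
        | x y v. x \<in> carrier R \<and> y \<in> carrier R}
    \<union> {frag_of (x, v + w) - frag_of (x, v) - frag_of (x, w) | x v w. x \<in> carrier R}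
    \<union> {frag_of (x \<otimes>\<^bsub>R\<^esub> s, v) - frag_of (x, act s v) | x s v. x \<in> carrier R \<and> s \<in> P}"
  have A: "lmult y a \<in> T" if "a \<in> ?A" for a
    using that
  proof (elim UnE CollectE exE conjE)
    fix x z v assume "a = frag_of (x \<oplus>\<^bsub>R\<^esub> z, v) - frag_of (x, v) - frag_of (z, v)"
      "x \<in> carrier R" "z \<in> carrier R"
    then show ?thesis using y tensor_rels_left_distrib[of "y \<otimes>\<^bsub>R\<^esub> x" "y \<otimes>\<^bsub>R\<^esub> z" v]
      by (simp add: frag_extend_diff r_distr)
  next
    fix x v w assume "a = frag_of (x, v + w) - frag_of (x, v) - frag_of (x, w)" "x \<in> carrier R"
    then show ?thesis using y tensor_rels_right_distrib[of "y \<otimes>\<^bsub>R\<^esub> x" v w]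
      by (simp add: frag_extend_diff)
  next
    fix x s v assume "a = frag_of (x \<otimes>\<^bsub>R\<^esub> s, v) - frag_of (x, act s v)" "x \<in> carrier R" "s \<in> P"
    moreover have "s \<in> carrier R" using P \<open>s \<in> P\<close> by blast
    ultimately show ?thesis using y tensor_rels_balanced[of "y \<otimes>\<^bsub>R\<^esub> x" s v]
      by (simp add: frag_extend_diff m_assoc)
  qed
  have Acarr: "?A \<subseteq> T" unfolding tensor_rels_def by (blast intro: generate.incl)
  show ?thesis
    using f unfolding tensor_rels_def
  proof (induction rule: generate.induct)
    case (inv a)
    then have "a \<in> T" using Acarr by blast
    then have "Poly_Mapping.keys a \<subseteq> carrier R \<times> UNIV"
      using subgroup.mem_carrier[OF subgroup_tensor_rels] by (simp add: pair_group_def)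
    then have "lmult y (inv\<^bsub>pair_group R\<^esub> a) = - lmult y a"
      by (simp add: pair_group_def frag_extend_minus)
    then show ?case using tensor_rels_uminus[OF A[OF inv]] by (simp add: tensor_rels_def)
  next
    case (eng a b)
    then show ?case using tensor_rels_add
      by (simp add: pair_group_def frag_extend_add tensor_rels_def)
  qed (use A tensor_rels_zero in \<open>auto simp: pair_group_def tensor_rels_def\<close>)
qed

lemma r_coset_tensor_rels: "T #>\<^bsub>pair_group R\<^esub> f = (\<lambda>t. t + f) ` T"
  by (auto simp: r_coset_def pair_group_def)

lemma r_coset_eqI:
  assumes "f - g \<in> T"
  shows "T #>\<^bsub>pair_group R\<^esub> f = T #>\<^bsub>pair_group R\<^esub> g"
proof -
  have "t + f \<in> (\<lambda>t. t + g) ` T" if "t \<in> T" for t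
    using tensor_rels_add[OF that assms] by (intro image_eqI[of _ _ "t + (f - g)"]) auto
  moreover have "t + g \<in> (\<lambda>t. t + f) ` T" if "t \<in> T" for t
    using tensor_rels_diff[OF that assms] by (intro image_eqI[of _ _ "t - (f - g)"]) auto
  ultimately show ?thesis unfolding r_coset_tensor_rels by blast
qed

text \<open>By \<open>tensor_rels_lmult\<close> all representatives of the coset contribute the same
  coset, so the union defining the action collapses to a single one.\<close>

lemma induced_action_tensor:
  assumes y: "y \<in> carrier R"
  shows "induced_action R P act y (tensor R P act x v) = tensor R P act (y \<otimes>\<^bsub>R\<^esub> x) v"
proof -
  have "T #>\<^bsub>pair_group R\<^esub> lmult y (t + frag_of (x, v)) = T #>\<^bsub>pair_group R\<^esub> frag_of (y \<otimes>\<^bsub>R\<^esub> x, v)"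
    if "t \<in> T" for t
    using tensor_rels_lmult[OF that y] by (intro r_coset_eqI) (simp add: frag_extend_add)
  then show ?thesis
    using tensor_rels_zero unfolding induced_action_def tensor_def
    by (auto simp: r_coset_tensor_rels[of "frag_of (x, v)"])
qed

end

section \<open>The annihilator of the vacuum in the induced module\<close>

context
  fixes n m :: nat and h p :: complex and act :: "gen free_alg set \<Rightarrow> complex \<Rightarrow> complex"
  assumes vac: "vacuum_module n m h p act"
begin

abbreviation (input) "TW \<equiv> tensor_rels (Uq n m h) (P_alg n m h) act"
abbreviation (input) "cl \<equiv> Uq_class n m h"
abbreviation (input) "FA' \<equiv> carrier (free_algebra (gens n m))"

text \<open>Expresses f|0> = 0 without cosets: the symbol lies in the subgroup that is factored
  out.\<close>

definition vac_ann :: "gen free_alg set" where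
  "vac_ann = {f \<in> FA'. frag_of (cl f, 1) \<in> TW}"

lemmas TW_add = tensor_rels_add[OF ring_Uq P_alg_subset, where act = act]
lemmas TW_diff = tensor_rels_diff[OF ring_Uq P_alg_subset, where act = act]

lemma frag_class_add:
  assumes "f \<in> FA'" "g \<in> FA'"
  shows "frag_of (cl (f + g), 1) - frag_of (cl f, 1) - frag_of (cl g, 1) \<in> TW"
  using assms by (simp add: Uq_class_add tensor_rels_left_distrib[OF ring_Uq P_alg_subset])

lemma vac_annI:
  assumes "f \<in> FA'" "g \<in> FA'" "frag_of (cl f, 1) - frag_of (cl g, 1) \<in> TW"
  shows "f - g \<in> vac_ann"
proof -
  \<comment> \<open>\<open>(f - g) + g\<close> is \<open>f\<close>, so the subtracted bracket is an
    additivity relation for \<open>f - g\<close> and \<open>g\<close>.\<close>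
  have "frag_of (cl (f - g), 1) = (frag_of (cl f, 1) - frag_of (cl g, 1))
      - (frag_of (cl ((f - g) + g), 1) - frag_of (cl (f - g), 1) - frag_of (cl g, 1))"
    by simp
  also have "\<dots> \<in> TW"
    by (rule TW_diff[OF assms(3) frag_class_add]) (use assms in auto)
  finally show ?thesis using assms by (auto simp: vac_ann_def)
qed

lemma vac_annD:
  assumes "f \<in> FA'" "g \<in> FA'" "f - g \<in> vac_ann"
  shows "tensor (Uq n m h) (P_alg n m h) act (cl f) 1 = tensor (Uq n m h) (P_alg n m h) act (cl g) 1"
proof -
  have "frag_of (cl f, 1) - frag_of (cl g, 1) = frag_of (cl (f - g), 1)
      + (frag_of (cl ((f - g) + g), 1) - frag_of (cl (f - g), 1) - frag_of (cl g, 1))"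
    by simp
  also have "\<dots> \<in> TW"
    by (rule TW_add[OF _ frag_class_add]) (use assms in \<open>auto simp: vac_ann_def\<close>)
  finally show ?thesis
    unfolding tensor_def by (rule r_coset_eqI[OF ring_Uq P_alg_subset])
qed

text \<open>The classes of \<open>f\<close> and of \<open>scal c\<close> both lie in
  \<open>P_alg\<close> and can be carried across the tensor sign, where each turns 1 into c.\<close>

lemma vac_ann_act:
  assumes f: "f \<in> FA'" "cl f \<in> P_alg n m h" and c: "act (cl f) 1 = c"
  shows "f - scal c \<in> vac_ann"
proof -
  interpret ring "Uq n m h" by (rule ring_Uq)
  have scal: "cl (scal c) \<in> P_alg n m h" "act (cl (scal c)) 1 = c"
    using vac by (auto simp: vacuum_module_def P_alg_def intro: generate_ring.incl)
  have *: "frag_of (cl g, 1) - frag_of (\<one>\<^bsub>Uq n m h\<^esub>, act (cl g) 1) \<in> TW"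
    if "g \<in> FA'" "cl g \<in> P_alg n m h" for g
    using tensor_rels_balanced[OF ring_Uq P_alg_subset one_closed that(2), where act = act and v = 1] that
    by simp
  have "frag_of (cl f, 1) - frag_of (cl (scal c), 1) \<in> TW"
    using TW_diff[OF *[OF f] *[OF _ scal(1)]] c scal(2) by simp
  then show ?thesis using f by (intro vac_annI) auto
qed

text \<open>\<open>P_alg\<close> is generated by brackets with a_j^+ first, while the vacuum
  condition has a_i^- first; the two brackets differ by the scalar -(-1)^{\<theta>_i
  \<theta>_j}.\<close>

lemma sbr_minus_plus_P_alg:
  assumes "i \<in> {1..n+m}" "j \<in> {1..n+m}" "i \<noteq> j"
  shows "sbr n 1 (Egen 0 i) (Egen j 0) \<in> FA'"
    and "cl (sbr n 1 (Egen 0 i) (Egen j 0)) \<in> P_alg n m h"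
proof -
  have E: "gvar (Egen i j) \<in> FA'" if "i \<le> n+m" "j \<le> n+m" "i \<noteq> j" for i j
    using that by (intro free_algebra_closed) (auto simp: gens_def)
  have C: "sbr n 1 (Egen 0 i) (Egen j 0) \<in> FA'" "sbr n 1 (Egen j 0) (Egen 0 i) \<in> FA'"
    using assms by (auto simp: sbr_def intro!: E free_algebra_closed_op)
  then show "sbr n 1 (Egen 0 i) (Egen j 0) \<in> FA'" by blast
  define s :: complex where "s = (-1) ^ (\<theta> n i * \<theta> n j)"
  have "s * s = 1" by (simp add: s_def flip: power_add)
  then have "sbr n 1 (Egen 0 i) (Egen j 0) = scal (- s) * sbr n 1 (Egen j 0) (Egen 0 i)"
    by (simp add: sbr_def mult.commute[of "\<theta> n j"] scal_uminus right_diff_distrib flip: s_def)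
  then have "cl (sbr n 1 (Egen 0 i) (Egen j 0)) = cl (scal (- s)) \<otimes>\<^bsub>Uq n m h\<^esub> cl (sbr n 1 (Egen j 0) (Egen 0 i))"
    using C by (simp add: Uq_class_mult)
  also have "\<dots> \<in> P_alg n m h"
    unfolding P_alg_def using assms by (intro generate_ring.eng_mult generate_ring.incl) blast+
  finally show "cl (sbr n 1 (Egen 0 i) (Egen j 0)) \<in> P_alg n m h" .
qed

lemma vacuum_ideal_vac_ann: "vacuum_ideal n m h p vac_ann"
proof
  interpret U: ring "Uq n m h" by (rule ring_Uq)
  have 0: "cl 0 = \<zero>\<^bsub>Uq n m h\<^esub>"
    using ring_hom_zero[OF ring_hom_ring.homh[OF ring_hom_Uq_class] ring_free_algebra ring_Uq] by simp
  show zero: "0 \<in> vac_ann"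
    using vac_annI[of 0 0] by (simp add: tensor_rels_zero[OF ring_Uq P_alg_subset])
  show "f + g \<in> vac_ann" if "f \<in> vac_ann" "g \<in> vac_ann" for f g
  proof -
    have "frag_of (cl (f + g), 1) = (frag_of (cl (f + g), 1) - frag_of (cl f, 1) - frag_of (cl g, 1))
        + (frag_of (cl f, 1) + frag_of (cl g, 1))" by simp
    also have "\<dots> \<in> TW"
      by (rule TW_add[OF frag_class_add TW_add]) (use that in \<open>auto simp: vac_ann_def\<close>)
    finally show ?thesis using that by (auto simp: vac_ann_def)
  qed
  show "x * f \<in> vac_ann" if "x \<in> FA'" "f \<in> vac_ann" for x f
    using tensor_rels_lmult[OF ring_Uq P_alg_subset, where act = act and f = "frag_of (cl f, 1)" and y = "cl x"] that
    by (auto simp: vac_ann_def Uq_class_mult)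
  show "u * x \<in> vac_ann"
    if "u \<in> cartan_rels n m h \<union> pos_rels n m h \<union> neg_rels n m h \<union> mixed_rels n m h" "x \<in> FA'" for u x
  proof -
    have u: "u \<in> FA'" using that Uq_relations_closed by blast
    have "cl (u * x) = cl 0"
      using that u Uq_class_rel[OF that(1)] by (simp add: Uq_class_mult 0)
    then show ?thesis using zero that u by (auto simp: vac_ann_def)
  qed
  have P: "cl (gvar a) \<in> P_alg n m h" if "a \<in> cartan_gens n m \<or> (\<exists>i. a = Egen 0 i \<and> i \<in> {1..n+m})" for a
    using that unfolding P_alg_def by (intro generate_ring.incl) blast
  have C: "gvar a \<in> FA'" if "a \<in> gens n m" for a using that by blast
  fix i assume i: "i \<in> {1..n+m}"
  show "gvar (Hgen i) - scal p \<in> vac_ann"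
    by (rule vac_ann_act[OF C P]) (use i vac in \<open>auto simp: gens_def cartan_gens_def vacuum_module_def H_op_def\<close>)
  show "gvar (Lgen i) - scal (exp (h * p)) \<in> vac_ann"
    by (rule vac_ann_act[OF C P]) (use i vac in \<open>auto simp: gens_def cartan_gens_def vacuum_module_def\<close>)
  show "gvar (Linv i) - scal (exp (- (h * p))) \<in> vac_ann"
    by (rule vac_ann_act[OF C P]) (use i vac in \<open>auto simp: gens_def cartan_gens_def vacuum_module_def\<close>)
  have "gvar (Egen 0 i) - scal 0 \<in> vac_ann"
    by (rule vac_ann_act[OF C P]) (use i vac in \<open>auto simp: gens_def vacuum_module_def jac_minus_def\<close>)
  then show "gvar (Egen 0 i) \<in> vac_ann" by simp
  fix j assume j: "j \<in> {1..n+m}" "i \<noteq> j"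
  have "sbr n 1 (Egen 0 i) (Egen j 0) - scal 0 \<in> vac_ann"
    by (rule vac_ann_act[OF sbr_minus_plus_P_alg]) (use i j vac in \<open>auto simp: vacuum_module_def\<close>)
  then show "sbr n 1 (Egen 0 i) (Egen j 0) \<in> vac_ann" by simp
qed

interpretation vacuum_ideal n m h p vac_ann by (rule vacuum_ideal_vac_ann)

abbreviation (input) "\<nu> f \<equiv> tensor (Uq n m h) (P_alg n m h) act (cl f) 1"

lemma W_act_class:
  assumes "f \<in> FA'" "g \<in> FA'"
  shows "W_act n m h act (cl f) (\<nu> g) = \<nu> (f * g)"
  unfolding W_act_def using assms
  by (simp add: Uq_class_mult induced_action_tensor[OF ring_Uq P_alg_subset])

lemma plus_monomial_closed: "plus_monomial r \<in> FA'"
  unfolding plus_monomial_def by (rule plus_word_C) auto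

lemma W_vec_eq: "W_vec n m h act r = \<nu> (plus_monomial r)"
proof -
  have "foldr (\<lambda>i x. (jac_plus n m h i [^]\<^bsub>Uq n m h\<^esub> r i) \<otimes>\<^bsub>Uq n m h\<^esub> x) xs \<one>\<^bsub>Uq n m h\<^esub> = cl (plus_word xs r 1)"
    if "set xs \<subseteq> {1..n+m}" for xs
    using that
  proof (induction xs)
    case (Cons j xs)
    have "E j 0 ^ r j \<in> FA'" "E j 0 \<in> FA'" "plus_word xs r 1 \<in> FA'"
      using Cons.prems by (auto intro!: free_algebra_closed_power plus_word_C)
    then show ?case using Cons by (simp add: Uq_class_mult Uq_class_power jac_plus_def)
  qed (simp add: Uq_class_one)
  moreover have "set [1..<n+m+1] \<subseteq> {1..n+m}" by auto
  ultimately have "foldr (\<lambda>i x. (jac_plus n m h i [^]\<^bsub>Uq n m h\<^esub> r i) \<otimes>\<^bsub>Uq n m h\<^esub> x) [1..<n+m+1] \<one>\<^bsub>Uq n m h\<^esub> = cl (plus_monomial r)"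
    unfolding plus_monomial_def by blast
  then show ?thesis
    using W_act_class[OF plus_monomial_closed, of 1 r]
    unfolding W_vec_def W_vacuum_def by (simp add: Uq_class_one del: upt_Suc)
qed

text \<open>Scaling is itself the action of the class of \<open>scal c\<close>, so each formula of
  the theorem reduces to a congruence in the free algebra.\<close>

lemma W_act_eq_W_scale:
  assumes "f \<in> FA'" "f * plus_monomial r - scal c * plus_monomial r' \<in> vac_ann"
  shows "W_act n m h act (cl f) (W_vec n m h act r) = W_scale n m h act c (W_vec n m h act r')"
  using assms vac_annD[of "f * plus_monomial r" "scal c * plus_monomial r'"] plus_monomial_closed
  by (simp add: W_scale_def W_vec_eq W_act_class)

end

theorem theorem2:
  fixes n m :: nat and h p :: complex
    and act :: "gen free_alg set \<Rightarrow> complex \<Rightarrow> complex"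
    and r :: "nat \<Rightarrow> nat" and i :: nat
  assumes "n + m \<ge> 1"
    and "\<forall>k::nat. k > 0 \<longrightarrow> exp h ^ k \<noteq> 1"
    and "vacuum_module n m h p act"
    and "r \<in> basis_labels n m"
    and "i \<in> {1..n+m}"
  shows "W_act n m h act (H_op n m h i) (W_vec n m h act r) =
           W_scale n m h act
             (p - (-1) ^ \<theta> n i * of_nat (r i) - (\<Sum>j=1..n+m. of_nat (r j)))
             (W_vec n m h act r)
       \<and> W_act n m h act (jac_minus n m h i) (W_vec n m h act r) =
           W_scale n m h act
             ((-1) ^ (\<Sum>j=1..<i. \<theta> n j * r j) * exp (h * (\<Sum>j=1..<i. of_nat (r j)))
                * qnum h (of_nat (r i)) * qnum h (p - (\<Sum>j=1..n+m. of_nat (r j)) + 1))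
             (W_vec n m h act (r(i := r i - 1)))
       \<and> W_act n m h act (jac_plus n m h i) (W_vec n m h act r) =
           W_scale n m h act
             ((-1) ^ (\<Sum>j=1..<i. \<theta> n j * r j) * exp (- (h * (\<Sum>j=1..<i. of_nat (r j))))
                * (1 - of_nat (\<theta> n i * r i)))
             (W_vec n m h act (r(i := r i + 1)))"
proof -
  interpret vacuum_ideal n m h p "vac_ann n m h act"
    by (rule vacuum_ideal_vac_ann[OF assms(3)])
  note scale = W_act_eq_W_scale[OF assms(3)]
  have i: "1 \<le> i" "i \<le> n + m" using assms(5) by auto
  have r: "r i \<le> 1" if "\<theta> n i \<noteq> 0"
  proof -
    have "i \<in> {n+1..n+m}" using that assms(5) by (auto simp: \<theta>_def split: if_splits)
    then have "r i \<in> {0, 1}" using assms(4) unfolding basis_labels_def by blast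
    then show ?thesis by auto
  qed
  \<comment> \<open>The instance k = 2: q^2 different from 1 makes q - q^-1 nonzero.\<close>
  have "exp h * exp h \<noteq> 1"
    using assms(2)[rule_format, of 2] by (simp add: power2_eq_square)
  then have q: "qdiff h \<noteq> 0"
    by (auto simp: qdiff_def exp_minus field_simps)
  show ?thesis
    unfolding H_op_def jac_minus_def jac_plus_def
    by (intro conjI scale H_plus_monomial[unfolded eqv_def] minus_plus_monomial[unfolded eqv_def] plus_plus_monomial[unfolded eqv_def]) (use i r q in auto)
qed

end
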